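(* Let $d\in\{1,2,3\}$, let $\boldsymbol{M}=(M_1,\dots,M_d)$ be such that $\mathcal{F}(\boldsymbol{M})$ is nonempty, and let $M_1<\mu<1$. Then $D_{\min}^{(d)}(\boldsymbol{M},\mu)$ is given as follows. (i) For $d=1$: $$D_{\min}^{(1)}(\boldsymbol{M},\mu)=(1-M_1)\log\frac{1-M_1}{1-\mu}+M_1\log\frac{M_1}{\mu}.$$ (ii) For $d=2$: $$D_{\min}^{(2)}(\boldsymbol{M},\mu)=\frac{(1-M_1)^2}{1-2M_1+M_2}\log\Big(1-\Big(\frac{M_1-M_2}{1-M_1}-\mu\Big)\nu^{(2)}\Big)+\frac{M_2-M_1^2}{1-2M_1+M_2}\log\big(1-(1-\mu)\nu^{(2)}\big),$$ where $$\nu^{(2)}=\frac{(1-M_1)(M_1-\mu)}{(1-M_1)\mu^2-(1-M_2)\mu+M_1-M_2}.$$ (iii) For $d=3$: if $M_1=M_2=M_3$, then $D_{\min}^{(3)}(\boldsymbol{M},\mu)=D_{\min}^{(1)}((M_1),\mu)$, i.e. the expression in (i). Otherwise $$D_{\min}^{(3)}(\boldsymbol{M},\mu)=\sum_{l=1}^3 f_l\log(1-\bar x_l\,\nu^{(3)}),$$ where $$(\bar x_1,\bar x_2,\bar x_3)=\Big(-\mu,\ \frac{M_2-M_3}{M_1-M_2}-\mu,\ 1-\mu\Big),$$ $$f_2=\frac{(M_1-M_2)^3}{(M_2-M_3)(M_1-2M_2+M_3)},\qquad f_3=\frac{M_1M_3-M_2^2}{M_1-2M_2+M_3},\qquad f_1=1-f_2-f_3,$$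 $$\nu^{(3)}=\begin{cases}\dfrac{-b+\sqrt{b^2+4ac}}{2a}, & a\ne 0,\\[2mm] \dfrac{c}{b}, & a=0,\end{cases}$$ with $$a=\bar x_1\bar x_2\bar x_3,\qquad b=(M_2-2\mu M_1+\mu^2)+(\bar x_1+\bar x_2+\bar x_3)(\mu-M_1),\qquad c=\mu-M_1.$$
   Context: $\mathcal{F}$ is the family of all (Borel) probability distributions on $[0,1]$, and $\mathrm{E}_F[\cdot]$ denotes expectation when $X$ has distribution $F$. The Kullback-Leibler divergence is $D(F\Vert G)=\mathrm{E}_F[\log \frac{\mathrm{d}F}{\mathrm{d}G}]$ if the density $\frac{\mathrm{d}F}{\mathrm{d}G}$ exists, and $D(F\Vert G)=+\infty$ otherwise. For $F\in\mathcal{F}$ and $\mu\in[0,1]$, $$D_{\min}(F,\mu)=\min_{G\in\mathcal{F}:\,\mathrm{E}_G[X]\ge\mu} D(F\Vert G).$$ For $\boldsymbol{M}=(M_1,\dots,M_d)$ let $\mathcal{F}(\boldsymbol{M})=\{F\in\mathcal{F}:(\mathrm{E}_F[X],\dots,\mathrm{E}_F[X^d])=\boldsymbol{M}\}$ and $D_{\min}^{(d)}(\boldsymbol{M},\mu)=\inf_{F\in\mathcal{F}(\boldsymbol{M})}D_{\min}(F,\mu)$. Conventions: $\log 0=-\infty$ and $0\cdot\log 0=0$ (a term whose coefficient is zero contributes zero). *)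

theory Defs
  imports "HOL-Probability.Probability"
begin

definition unit_distributions :: "real measure set" where
  "unit_distributions = {F. real_distribution F \<and> emeasure F {0..1} = 1}"

text \<open>
  The library's \<^const>\<open>KL_divergence\<close> takes the reference measure first and is real-valued, with
  the junk value 0 when the log-density is not integrable. The negative part of the log-density
  is always integrable with respect to \<open>F\<close>, so non-integrability means that the expectation
  is \<open>+\<infinity>\<close>.
\<close>

definition KL_div :: "real measure \<Rightarrow> real measure \<Rightarrow> ereal" where
  "KL_div F G =
    (if (\<exists>f \<in> borel_measurable G. density G f = F) \<and> integrable F (entropy_density (exp 1) G F)
     then ereal (KL_divergence (exp 1) G F) else \<infinity>)"

text \<open>The minimum over \<open>G\<close> is written as an infimum; it is attained for \<open>F\<close> on the unit
  interval and \<open>\<mu> \<in> [0,1]\<close>, by weak compactness and lower semicontinuity.\<close>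

definition D_min :: "real measure \<Rightarrow> real \<Rightarrow> ereal" where
  "D_min F \<mu> = (INF G \<in> {G \<in> unit_distributions. (\<integral>x. x \<partial>G) \<ge> \<mu>}. KL_div F G)"

text \<open>A moment vector \<open>(M\<^sub>1, \<dots>, M\<^sub>d)\<close> is a function on \<^typ>\<open>nat\<close>, of which only the values at
  \<open>1, \<dots>, d\<close> matter.\<close>

definition moment_class :: "nat \<Rightarrow> (nat \<Rightarrow> real) \<Rightarrow> real measure set" where
  "moment_class d M = {F \<in> unit_distributions. \<forall>i \<in> {1..d}. (\<integral>x. x ^ i \<partial>F) = M i}"

definition D_min_moments :: "nat \<Rightarrow> (nat \<Rightarrow> real) \<Rightarrow> real \<Rightarrow> ereal" where
  "D_min_moments d M \<mu> = (INF F \<in> moment_class d M. D_min F \<mu>)"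

text \<open>Logarithm with \<open>log 0 = -\<infinity>\<close>; the convention \<open>0 \<cdot> log 0 = 0\<close> is then
  multiplication on \<^typ>\<open>ereal\<close>.\<close>

definition elog :: "real \<Rightarrow> ereal" where
  "elog y = (if y \<le> 0 then -\<infinity> else ereal (ln y))"

end

theory Submission
  imports Defs
begin

text \<open>
  For \<open>0 \<le> \<nu> < 1 / (1 - \<mu>)\<close> the function \<open>1 - (x - \<mu>) \<nu>\<close> is positive on the unit interval and has
  \<open>G\<close>-mean at most 1 whenever \<open>G\<close> has mean at least \<open>\<mu>\<close>, so Gibbs' inequality bounds \<open>D(F \<parallel> G)\<close> below
  by the \<open>F\<close>-mean of \<open>ln (1 - (x - \<mu>) \<nu>)\<close>. All derivatives of this logarithm in \<open>x\<close> are negative; its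
  Hermite interpolants of degree \<open>d\<close> at the nodes \<open>{0, 1}\<close>, \<open>{t, t, 1}\<close>, \<open>{0, t, t, 1}\<close> (for \<open>d = 1, 2, 3\<close>)
  therefore lie below it. Hence, among all \<open>F\<close> with the given moments, the mean is least for the
  distribution \<open>F\<^sup>*\<close> with these moments that is supported on the nodes. Finally \<open>\<nu>\<close> is chosen such that
  \<open>F\<^sup>*\<close> has density \<open>1 - (x - \<mu>) \<nu>\<close> with respect to a distribution \<open>G\<^sup>*\<close> of mean \<open>\<mu>\<close> on the same
  nodes, and then the lower bound is attained at \<open>(F\<^sup>*, G\<^sup>*)\<close>.
\<close>

subsection \<open>Distributions on the unit interval\<close>

lemma unit_distributionsD:
  assumes "F \<in> unit_distributions"
  shows "prob_space F" "sets F = sets borel" "AE x in F. x \<in> {0..1}"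
proof -
  have F: "real_distribution F" and one: "emeasure F {0..1} = 1"
    using assms by (auto simp: unit_distributions_def)
  show p: "prob_space F" and s: "sets F = sets borel"
    using F by (auto simp: real_distribution_def real_distribution_axioms_def)
  show "AE x in F. x \<in> {0..1}"
    using one by (intro prob_space.AE_prob_1[OF p]) (simp add: measure_def)
qed

lemma integrable_unit_distribution:
  assumes F: "F \<in> unit_distributions" and f: "f \<in> borel_measurable borel"
    and bound: "\<And>x. 0 \<le> x \<Longrightarrow> x \<le> 1 \<Longrightarrow> \<bar>f x\<bar> \<le> B"
  shows "integrable F (f :: real \<Rightarrow> real)"
proof -
  interpret prob_space F using unit_distributionsD(1)[OF F] .
  have "AE x in F. norm (f x) \<le> B"
    using unit_distributionsD(3)[OF F] by eventually_elim (use bound in auto)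
  moreover have "f \<in> borel_measurable F"
    using f unit_distributionsD(2)[OF F] by (simp cong: measurable_cong_sets)
  ultimately show ?thesis by (rule integrable_const_bound)
qed

lemma integrable_power_unit_distribution:
  assumes "F \<in> unit_distributions"
  shows "integrable F (\<lambda>x. x ^ n :: real)"
  using assms by (rule integrable_unit_distribution[where B = 1]) (auto simp: power_le_one)

lemma tilt_bounds:
  fixes x \<mu> \<nu> :: real
  assumes "0 \<le> \<nu>" "0 \<le> x" "x \<le> 1"
  shows "1 - (1 - \<mu>) * \<nu> \<le> 1 - (x - \<mu>) * \<nu>" "1 - (x - \<mu>) * \<nu> \<le> 1 + \<mu> * \<nu>"
  using assms by (auto simp: algebra_simps mult_left_le)

text \<open>The strict inequality on \<open>\<nu>\<close> keeps the argument of the logarithm away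
  from 0 on the whole interval, so the integrand is bounded.\<close>

lemma integrable_ln_tilt:
  fixes \<mu> \<nu> :: real
  assumes F: "F \<in> unit_distributions" and \<nu>: "0 \<le> \<nu>" "(1 - \<mu>) * \<nu> < 1"
  shows "integrable F (\<lambda>x. ln (1 - (x - \<mu>) * \<nu>))"
proof (rule integrable_unit_distribution[OF F])
  fix x :: real assume x: "0 \<le> x" "x \<le> 1"
  have "ln (1 - (1 - \<mu>) * \<nu>) \<le> ln (1 - (x - \<mu>) * \<nu>)" "ln (1 - (x - \<mu>) * \<nu>) \<le> ln (1 + \<mu> * \<nu>)"
    using tilt_bounds[OF \<nu>(1) x, of \<mu>] \<nu> by (auto simp del: ln_le_cancel_iff intro!: ln_mono)
  then show "\<bar>ln (1 - (x - \<mu>) * \<nu>)\<bar> \<le> \<bar>ln (1 - (1 - \<mu>) * \<nu>)\<bar> + \<bar>ln (1 + \<mu> * \<nu>)\<bar>"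
    by linarith
qed measurable

subsection \<open>The dual lower bound\<close>

text \<open>With \<open>h x = 1 - (x - \<mu>) * \<nu>\<close> and \<open>D\<close> the density of
  \<open>F\<close> with respect to \<open>G\<close>, integrate
  \<open>ln (h x / D x) \<le> h x / D x - 1\<close> over \<open>F\<close>: the right side has
  integral at most the \<open>G\<close>-mean of \<open>h\<close> minus 1, which is at most 0. If
  there is no density or its logarithm is not integrable, the divergence is infinite.\<close>

lemma KL_div_ge:
  fixes \<mu> \<nu> :: real
  assumes F: "F \<in> unit_distributions" and G: "G \<in> unit_distributions"
    and mean: "\<mu> \<le> (\<integral>x. x \<partial>G)" and \<nu>: "0 \<le> \<nu>" "(1 - \<mu>) * \<nu> < 1"
  shows "ereal (\<integral>x. ln (1 - (x - \<mu>) * \<nu>) \<partial>F) \<le> KL_div F G"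
proof (cases "(\<exists>f \<in> borel_measurable G. density G f = F) \<and> integrable F (entropy_density (exp 1) G F)")
  case True
  then obtain f where f: "f \<in> borel_measurable G" "density G f = F" by auto
  interpret F: prob_space F using unit_distributionsD(1)[OF F] .
  interpret G: prob_space G using unit_distributionsD(1)[OF G] .
  define h where "h x = 1 - (x - \<mu>) * \<nu>" for x :: real
  have sF [measurable_cong]: "sets F = sets borel" and sG [measurable_cong]: "sets G = sets borel"
    using unit_distributionsD(2) F G by auto
  have h_pos: "0 < h x" if "0 \<le> x" "x \<le> 1" for x
    using tilt_bounds(1)[OF \<nu>(1) that, of \<mu>] \<nu> unfolding h_def by linarith
  have [measurable]: "h \<in> borel_measurable borel" unfolding h_def by measurable
  have ac: "absolutely_continuous G F"
    using absolutely_continuousI_density[OF f(1)] f(2) by simp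
  have sFG: "sets F = sets G" by (simp add: sF sG)
  obtain D where D: "D \<in> borel_measurable G" "AE x in G. RN_deriv G F x = ennreal (D x)"
      "AE x in F. 0 < D x" "\<And>x. 0 \<le> D x"
    using G.real_RN_deriv[OF F.finite_measure_axioms ac sFG] by blast
  have [measurable]: "D \<in> borel_measurable borel"
    using D(1) sG by (simp cong: measurable_cong_sets)
  have "F = density G (RN_deriv G F)"
    using RN_derivI[OF f] by simp
  also have "\<dots> = density G (\<lambda>x. ennreal (D x))"
    using D by (intro density_cong) auto
  finally have N: "F = density G (\<lambda>x. ennreal (D x))" .
  have ed: "AE x in F. entropy_density (exp 1) G F x = ln (D x)"
    using absolutely_continuous_AE[OF sFG ac D(2)]
    by eventually_elim (simp add: entropy_density_def D(4) log_def)
  have m: "entropy_density (exp 1) G F \<in> borel_measurable F"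
    using measurable_entropy_density[of _ G F] sFG by (simp cong: measurable_cong_sets)
  have int_lnD: "integrable F (\<lambda>x. ln (D x))"
    using True integrable_cong_AE[OF m _ ed] by simp
  have KL: "KL_div F G = ereal (\<integral>x. ln (D x) \<partial>F)"
    using True integral_cong_AE[OF m _ ed] by (simp add: KL_div_def KL_divergence_def)
  have int_h: "integrable G h"
    using integrable_power_unit_distribution[OF G, of 1] unfolding h_def by simp
  have int_x: "integrable G (\<lambda>x. x)"
    using integrable_power_unit_distribution[OF G, of 1] by simp
  have h_mean: "(\<integral>x. h x \<partial>G) \<le> 1"
  proof -
    have "(\<integral>x. h x \<partial>G) = 1 - ((\<integral>x. x \<partial>G) - \<mu>) * \<nu>"
      unfolding h_def using int_x by (simp add: G.prob_space)
    then show ?thesis using mean \<nu>(1) by simp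
  qed
  \<comment> \<open>Division by zero yields 0, so this product is \<open>h x\<close> where
    \<open>D x > 0\<close> and 0 elsewhere. Mass of \<open>G\<close> outside the support of
    \<open>F\<close> is thereby dropped, which can only lower the mean because \<open>h\<close> is
    positive on the interval.\<close>
  have bnd: "AE x in G. norm (D x * (h x / D x)) \<le> norm (h x)"
    by (rule AE_I2) simp
  have int_q': "integrable G (\<lambda>x. D x * (h x / D x))"
    by (rule Bochner_Integration.integrable_bound[OF int_h _ bnd]) measurable
  have int_q: "integrable F (\<lambda>x. h x / D x)"
    unfolding N using int_q' D by (subst integrable_real_density) auto
  have "(\<integral>x. h x / D x \<partial>F) = (\<integral>x. D x * (h x / D x) \<partial>G)"
    unfolding N using D by (subst integral_real_density) auto
  also have "\<dots> \<le> (\<integral>x. h x \<partial>G)"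
  proof (rule integral_mono_AE[OF int_q' int_h])
    show "AE x in G. D x * (h x / D x) \<le> h x"
      using unit_distributionsD(3)[OF G]
      by eventually_elim (use h_pos in \<open>auto simp: less_imp_le\<close>)
  qed
  finally have q: "(\<integral>x. h x / D x \<partial>F) \<le> 1" using h_mean by simp
  have int_lnh: "integrable F (\<lambda>x. ln (h x))"
    using integrable_ln_tilt[OF F \<nu>] unfolding h_def .
  have "(\<integral>x. ln (h x) \<partial>F) \<le> (\<integral>x. ln (D x) + (h x / D x - 1) \<partial>F)"
  proof (rule integral_mono_AE[OF int_lnh])
    show "integrable F (\<lambda>x. ln (D x) + (h x / D x - 1))"
      using int_lnD int_q by simp
    show "AE x in F. ln (h x) \<le> ln (D x) + (h x / D x - 1)"
      using unit_distributionsD(3)[OF F] D(3)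
    proof eventually_elim
      case (elim x)
      then have "0 < h x / D x" "0 < h x" using h_pos by auto
      then show ?case using ln_le_minus_one[of "h x / D x"] elim by (simp add: ln_div)
    qed
  qed
  also have "\<dots> = (\<integral>x. ln (D x) \<partial>F) + ((\<integral>x. h x / D x \<partial>F) - 1)"
    using int_lnD int_q by (simp add: F.prob_space)
  finally show ?thesis using q unfolding KL h_def by simp
qed (auto simp: KL_div_def)

subsection \<open>Finitely supported distributions\<close>

text \<open>The index set decouples the atoms from their labels, so atoms may coincide.\<close>

definition finite_distr :: "'i set \<Rightarrow> ('i \<Rightarrow> real) \<Rightarrow> ('i \<Rightarrow> real) \<Rightarrow> real measure" where
  "finite_distr I x w = distr (point_measure I (\<lambda>i. ennreal (w i))) borel x"

lemma sets_finite_distr [simp, measurable_cong]: "sets (finite_distr I x w) = sets borel"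
  by (simp add: finite_distr_def)

lemma space_finite_distr [simp]: "space (finite_distr I x w) = UNIV"
  by (simp add: finite_distr_def)

lemma nn_integral_finite_distr:
  assumes "finite I" "f \<in> borel_measurable borel"
  shows "(\<integral>\<^sup>+y. f y \<partial>finite_distr I x w) = (\<Sum>i\<in>I. ennreal (w i) * f (x i))"
  unfolding finite_distr_def using assms
  by (subst nn_integral_distr) (auto simp: nn_integral_point_measure_finite)

lemma emeasure_finite_distr:
  assumes "finite I" "A \<in> sets borel"
  shows "emeasure (finite_distr I x w) A = (\<Sum>i\<in>I. ennreal (w i) * indicator A (x i))"
proof -
  have "emeasure (finite_distr I x w) A = (\<integral>\<^sup>+y. indicator A y \<partial>finite_distr I x w)"
    using assms by (intro nn_integral_indicator[symmetric]) simp
  then show ?thesis using nn_integral_finite_distr[of I "indicator A"] assms by simp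
qed

lemma integral_finite_distr:
  fixes f :: "real \<Rightarrow> real"
  assumes "finite I" "f \<in> borel_measurable borel" "\<And>i. i \<in> I \<Longrightarrow> 0 \<le> w i"
  shows "(\<integral>y. f y \<partial>finite_distr I x w) = (\<Sum>i\<in>I. w i * f (x i))"
  unfolding finite_distr_def using assms
  by (subst integral_distr) (auto simp: lebesgue_integral_point_measure_finite)

lemma integrable_finite_distr:
  fixes f :: "real \<Rightarrow> real"
  assumes "finite I" "f \<in> borel_measurable borel"
  shows "integrable (finite_distr I x w) f"
  unfolding finite_distr_def using assms
  by (subst integrable_distr_eq) (auto simp: integrable_point_measure_finite)

lemma finite_distr_unit:
  assumes I: "finite I" and w: "\<And>i. i \<in> I \<Longrightarrow> 0 \<le> w i" "(\<Sum>i\<in>I. w i) = 1"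
    and x: "\<And>i. i \<in> I \<Longrightarrow> x i \<in> {0..1}"
  shows "finite_distr I x w \<in> unit_distributions"
proof -
  have "emeasure (finite_distr I x w) A = 1" if "A \<in> sets borel" "\<And>i. i \<in> I \<Longrightarrow> x i \<in> A" for A
  proof -
    have "emeasure (finite_distr I x w) A = (\<Sum>i\<in>I. ennreal (w i))"
      using that by (simp add: emeasure_finite_distr I)
    also have "\<dots> = 1" using w by (subst sum_ennreal) auto
    finally show ?thesis .
  qed
  then show ?thesis
    using x by (auto simp: unit_distributions_def real_distribution_def real_distribution_axioms_def
        intro!: prob_spaceI)
qed

lemma density_finite_distr:
  fixes h :: "real \<Rightarrow> real"
  assumes I: "finite I" and g: "\<And>i. i \<in> I \<Longrightarrow> 0 \<le> g i"
    and h: "h \<in> borel_measurable borel"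
  shows "density (finite_distr I x g) (\<lambda>y. ennreal (h y)) = finite_distr I x (\<lambda>i. g i * h (x i))"
proof (rule measure_eqI)
  note [measurable] = h
  fix A assume "A \<in> sets (density (finite_distr I x g) (\<lambda>y. ennreal (h y)))"
  then have A [measurable]: "A \<in> sets borel" by simp
  have "emeasure (density (finite_distr I x g) (\<lambda>y. ennreal (h y))) A
      = (\<Sum>i\<in>I. ennreal (g i) * (ennreal (h (x i)) * indicator A (x i)))"
    by (subst emeasure_density) (auto simp: nn_integral_finite_distr I)
  also have "\<dots> = emeasure (finite_distr I x (\<lambda>i. g i * h (x i))) A"
    using g by (auto simp: emeasure_finite_distr I ennreal_mult' mult.assoc intro!: sum.cong)
  finally show "emeasure (density (finite_distr I x g) (\<lambda>y. ennreal (h y))) A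
      = emeasure (finite_distr I x (\<lambda>i. g i * h (x i))) A" .
qed simp

text \<open>The density is a function of the point and not of the label, so labels that share an
  atom agree. By uniqueness of the Radon-Nikodym derivative it is \<open>h\<close> almost
  everywhere, and the divergence is the mean of \<open>h y * ln (h y)\<close> under the second
  distribution.\<close>

lemma KL_div_finite_distr:
  fixes h :: "real \<Rightarrow> real"
  assumes I: "finite I" and g: "\<And>i. i \<in> I \<Longrightarrow> 0 \<le> g i" "(\<Sum>i\<in>I. g i) = 1"
    and x: "\<And>i. i \<in> I \<Longrightarrow> x i \<in> {0..1}"
    and h: "h \<in> borel_measurable borel" "\<And>y. y \<in> {0..1} \<Longrightarrow> 0 \<le> h y"
    and f: "\<And>i. i \<in> I \<Longrightarrow> f i = g i * h (x i)"
  shows "KL_div (finite_distr I x f) (finite_distr I x g) = ereal (\<Sum>i\<in>I. f i * ln (h (x i)))"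
proof -
  note [measurable] = h(1)
  let ?G = "finite_distr I x g" and ?F = "finite_distr I x f"
  have Gu: "?G \<in> unit_distributions" using finite_distr_unit[OF I g x] .
  interpret G: prob_space ?G using unit_distributionsD(1)[OF Gu] .
  have "?F = finite_distr I x (\<lambda>i. g i * h (x i))"
    unfolding finite_distr_def point_measure_def
    by (intro distr_cong density_cong arg_cong2[where f = density]) (auto simp: f AE_count_space)
  then have F: "?F = density ?G (\<lambda>y. ennreal (h y))"
    using density_finite_distr[of I g h x, OF I g(1) h(1)] by simp
  have nn: "AE y in ?G. 0 \<le> h y"
    using unit_distributionsD(3)[OF Gu] by eventually_elim (use h in auto)
  have "AE y in ?G. ennreal (h y) = RN_deriv ?G ?F y"
    by (rule G.RN_deriv_unique[OF _ F[symmetric]]) simp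
  \<comment> \<open>The factor \<open>h y\<close> stays because integrability under
    \<open>?F\<close> amounts to integrability of the product with \<open>h\<close> under
    \<open>?G\<close>.\<close>
  then have ed: "AE y in ?G. h y * entropy_density (exp 1) ?G ?F y = h y * ln (h y)"
    using nn
  proof eventually_elim
    case (elim y)
    have "enn2real (RN_deriv ?G ?F y) = h y" using elim(2) by (simp flip: elim(1))
    then show ?case by (simp add: entropy_density_def log_def)
  qed
  have m: "entropy_density (exp 1) ?G ?F \<in> borel_measurable ?G"
    by (rule measurable_entropy_density)
  have mh: "h \<in> borel_measurable ?G" "(\<lambda>y. h y * ln (h y)) \<in> borel_measurable ?G"
    by measurable
  have "integrable ?G (\<lambda>y. h y * ln (h y))"
    by (rule integrable_finite_distr[OF I]) measurable
  then have "integrable ?G (\<lambda>y. h y * entropy_density (exp 1) ?G ?F y)"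
    by (rule integrable_cong_AE[OF borel_measurable_times[OF mh(1) m] mh(2) ed, THEN iffD2])
  then have "integrable (density ?G (\<lambda>y. ennreal (h y))) (entropy_density (exp 1) ?G ?F)"
    by (rule integrable_real_density[OF mh(1) nn m, THEN iffD2])
  then have int: "integrable ?F (entropy_density (exp 1) ?G ?F)"
    by (rule subst[OF F[symmetric], of "\<lambda>N. integrable N (entropy_density (exp 1) ?G ?F)"])
  have "KL_divergence (exp 1) ?G ?F = (\<integral>y. h y * log (exp 1) (h y) \<partial>?G)"
    by (subst F, rule G.KL_density[OF _ mh(1) nn]) simp
  also have "\<dots> = (\<Sum>i\<in>I. g i * (h (x i) * ln (h (x i))))"
    using g by (subst integral_finite_distr) (auto simp: I log_def)
  also have "\<dots> = (\<Sum>i\<in>I. f i * ln (h (x i)))"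
    by (intro sum.cong) (auto simp: f)
  finally have KL: "KL_divergence (exp 1) ?G ?F = (\<Sum>i\<in>I. f i * ln (h (x i)))" .
  have "\<exists>k \<in> borel_measurable ?G. density ?G k = ?F"
    by (rule bexI[of _ "\<lambda>y. ennreal (h y)"]) (simp_all add: F)
  then show ?thesis using int KL by (simp add: KL_div_def)
qed

subsection \<open>Saddle points\<close>

text \<open>For a zero coefficient both sides are 0, since \<open>0 * (- \<infinity>) = 0\<close> in
  \<open>ereal\<close>; positivity of the argument matters only for positive coefficients.\<close>

lemma ereal_mult_elog:
  assumes "0 < f \<Longrightarrow> 0 < h" "0 \<le> f"
  shows "ereal f * elog h = ereal (f * ln h)"
  using assms by (cases "f = 0") (auto simp: elog_def)

text \<open>At \<open>\<nu> = 1 / (1 - \<mu>)\<close> the logarithm is unbounded near \<open>x = 1\<close>, so the dual bound is only used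
  for smaller parameters and transported to \<open>\<nu>\<close> by continuity of the sum.\<close>

lemma INF_D_min_eq:
  fixes \<mu> \<nu> :: real and C :: "real measure set"
  assumes I: "finite I" and x: "\<And>i. i \<in> I \<Longrightarrow> x i \<in> {0..1}"
    and g: "\<And>i. i \<in> I \<Longrightarrow> 0 \<le> g i" "(\<Sum>i\<in>I. g i) = 1" "(\<Sum>i\<in>I. g i * x i) = \<mu>"
    and \<nu>: "0 < \<nu>" "(1 - \<mu>) * \<nu> \<le> 1" and \<mu>: "\<mu> < 1"
    and f: "\<And>i. i \<in> I \<Longrightarrow> f i = g i * (1 - (x i - \<mu>) * \<nu>)"
    and C: "C \<subseteq> unit_distributions" "finite_distr I x f \<in> C"
    and moments: "\<And>F \<nu>'. F \<in> C \<Longrightarrow> 0 \<le> \<nu>' \<Longrightarrow> (1 - \<mu>) * \<nu>' < 1 \<Longrightarrow>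
      (\<Sum>i\<in>I. f i * ln (1 - (x i - \<mu>) * \<nu>')) \<le> (\<integral>y. ln (1 - (y - \<mu>) * \<nu>') \<partial>F)"
  shows "(INF F\<in>C. D_min F \<mu>) = (\<Sum>i\<in>I. ereal (f i) * elog (1 - (x i - \<mu>) * \<nu>))"
proof -
  define \<phi> where "\<phi> \<nu>' = (\<Sum>i\<in>I. f i * ln (1 - (x i - \<mu>) * \<nu>'))" for \<nu>'
  have h_nn: "0 \<le> 1 - (y - \<mu>) * \<nu>" if "y \<in> {0..1}" for y
  proof -
    have "1 - (1 - \<mu>) * \<nu> \<le> 1 - (y - \<mu>) * \<nu>"
      using that \<nu> by (intro tilt_bounds(1)) auto
    then show ?thesis using \<nu>(2) by linarith
  qed
  have f_nn: "0 \<le> f i" if "i \<in> I" for i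
    using f g h_nn x that by simp
  \<comment> \<open>Where the tilt vanishes, \<open>f i = g i * 0 = 0\<close>. So the only atoms
    with argument 0 in the logarithm carry no weight.\<close>
  have h_pos: "0 < 1 - (x i - \<mu>) * \<nu>" if "i \<in> I" "f i \<noteq> 0" for i
    using f[OF that(1)] h_nn[OF x[OF that(1)]] that(2) by (cases "1 - (x i - \<mu>) * \<nu> = 0") auto
  have rhs: "(\<Sum>i\<in>I. ereal (f i) * elog (1 - (x i - \<mu>) * \<nu>)) = ereal (\<phi> \<nu>)"
    unfolding \<phi>_def sum_ereal[symmetric]
    using f_nn h_pos by (intro sum.cong) (auto intro!: ereal_mult_elog)
  \<comment> \<open>Terms with zero weight are constant; in all others the logarithm is continuous
    at \<open>\<nu>\<close>.\<close>
  have "(\<phi> \<longlongrightarrow> \<phi> \<nu>) (at_left \<nu>)"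
    unfolding \<phi>_def
  proof (rule tendsto_sum)
    fix i assume i: "i \<in> I"
    show "((\<lambda>\<nu>'. f i * ln (1 - (x i - \<mu>) * \<nu>')) \<longlongrightarrow> f i * ln (1 - (x i - \<mu>) * \<nu>)) (at_left \<nu>)"
      by (cases "f i = 0") (use h_pos[OF i] in \<open>auto intro!: tendsto_eq_intros\<close>)
  qed
  moreover have "\<forall>\<^sub>F \<nu>' in at_left \<nu>. 0 \<le> \<nu>' \<and> (1 - \<mu>) * \<nu>' < 1"
  proof -
    have "\<forall>\<^sub>F \<nu>' in at_left \<nu>. \<nu>' \<in> {0<..<\<nu>}"
      using \<nu>(1) by (rule eventually_at_left_real)
    then show ?thesis
    proof eventually_elim
      case (elim \<nu>')
      then have "(1 - \<mu>) * \<nu>' < (1 - \<mu>) * \<nu>" using \<mu> by simp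
      then show ?case using elim \<nu> by auto
    qed
  qed
  \<comment> \<open>The dual bound holds for all slightly smaller parameters and its right side does
    not depend on them, so it survives the limit.\<close>
  ultimately have lower: "ereal (\<phi> \<nu>) \<le> KL_div F G"
    if F: "F \<in> C" and G: "G \<in> unit_distributions" "\<mu> \<le> (\<integral>x. x \<partial>G)" for F G
  proof -
    assume lim: "(\<phi> \<longlongrightarrow> \<phi> \<nu>) (at_left \<nu>)"
      and ev: "\<forall>\<^sub>F \<nu>' in at_left \<nu>. 0 \<le> \<nu>' \<and> (1 - \<mu>) * \<nu>' < 1"
    have "\<forall>\<^sub>F \<nu>' in at_left \<nu>. ereal (\<phi> \<nu>') \<le> KL_div F G"
      using ev
    proof eventually_elim
      case (elim \<nu>')
      have "ereal (\<phi> \<nu>') \<le> ereal (\<integral>y. ln (1 - (y - \<mu>) * \<nu>') \<partial>F)"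
        using moments[OF F] elim by (simp add: \<phi>_def)
      also have "\<dots> \<le> KL_div F G"
        using KL_div_ge[of F G \<mu> \<nu>'] F C(1) G elim by auto
      finally show ?case .
    qed
    then show ?thesis
      by (intro tendsto_upperbound[where F = "at_left \<nu>" and f = "\<lambda>\<nu>'. ereal (\<phi> \<nu>')"])
        (use lim in auto)
  qed
  let ?F = "finite_distr I x f" and ?G = "finite_distr I x g"
  \<comment> \<open>By the hypothesis on \<open>f\<close>, the tilt is the density of
    \<open>?F\<close> with respect to \<open>?G\<close>, so this pair attains the dual
    bound.\<close>
  have KL: "KL_div ?F ?G = ereal (\<phi> \<nu>)"
    unfolding \<phi>_def using h_nn f by (intro KL_div_finite_distr[OF I g(1,2) x]) auto
  have G: "?G \<in> unit_distributions" "(\<integral>y. y \<partial>?G) = \<mu>"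
    using finite_distr_unit[OF I g(1,2) x] integral_finite_distr[OF I, of "\<lambda>y. y" g x] g
    by (auto simp: mult.commute)
  show ?thesis
    unfolding rhs D_min_def
  proof (rule antisym)
    show "(INF F\<in>C. INF G\<in>{G \<in> unit_distributions. \<mu> \<le> (\<integral>x. x \<partial>G)}. KL_div F G) \<le> ereal (\<phi> \<nu>)"
      using C(2) G by (intro INF_lower2[OF C(2)] INF_lower2[of ?G]) (auto simp: KL)
    show "ereal (\<phi> \<nu>) \<le> (INF F\<in>C. INF G\<in>{G \<in> unit_distributions. \<mu> \<le> (\<integral>x. x \<partial>G)}. KL_div F G)"
      using lower by (auto intro!: INF_greatest)
  qed
qed

subsection \<open>Polynomial minorants of the logarithm\<close>

text \<open>The interpolation error of \<open>ln (1 - s x)\<close> vanishes at \<open>s = 0\<close>, and its derivative in \<open>s\<close> is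
  the interpolation error of \<open>- x / (1 - s x)\<close>, an explicit nonnegative rational function.\<close>

lemma ln_ge_interpolation_0_1:
  fixes x s :: real
  assumes x: "0 \<le> x" "x \<le> 1" and s: "0 \<le> s" "s < 1"
  shows "ln (1 - s) * x \<le> ln (1 - s * x)"
proof -
  define e where "e r = ln (1 - r * x) - ln (1 - r) * x" for r
  have "e 0 \<le> e s"
  proof (rule DERIV_nonneg_imp_nondecreasing[OF s(1)])
    fix r assume r: "0 \<le> r" "r \<le> s"
    have "r * x \<le> r" using r x by (simp add: mult_left_le)
    then have pos: "0 < 1 - r" "0 < 1 - r * x" using r s by auto
    have "(e has_real_derivative - x / (1 - r * x) + x / (1 - r)) (at r)"
      unfolding e_def using pos by (auto intro!: derivative_eq_intros)
    \<comment> \<open>For any nodes, the interpolation error of \<open>1 / (1 - r * x)\<close> is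
      the product of \<open>r * (x - n) / (1 - r * n)\<close> over the nodes \<open>n\<close>,
      divided by \<open>1 - r * x\<close>. For \<open>r > 0\<close> the function
      \<open>- x / (1 - r * x)\<close> is a constant minus \<open>1 / r\<close> times this one,
      which yields the right side here and in the two lemmas below.\<close>
    moreover have "- x / (1 - r * x) + x / (1 - r) = r * x * (1 - x) / ((1 - r * x) * (1 - r))"
      using pos by (simp add: divide_simps) algebra
    moreover have "0 \<le> r * x * (1 - x) / ((1 - r * x) * (1 - r))"
      using pos r x by simp
    ultimately show "\<exists>y. (e has_real_derivative y) (at r) \<and> 0 \<le> y" by metis
  qed
  then show ?thesis by (simp add: e_def)
qed

text \<open>The left side is the quadratic in \<open>x\<close> that matches value and slope of the
  logarithm at \<open>t\<close> and its value at 1. The basis \<open>1 - x\<close>,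
  \<open>(1 - x) * (x - t)\<close>, \<open>(x - t)\<^sup>2\<close> lets each condition determine one
  coefficient in turn. The double node makes the error factor in \<open>x - t\<close> a square, so
  its sign does not change at \<open>t\<close>.\<close>

lemma ln_ge_interpolation_t_t_1:
  fixes x s t :: real
  assumes x: "0 \<le> x" "x \<le> 1" and s: "0 \<le> s" "s < 1" and t: "0 \<le> t" "t < 1"
  shows "ln (1 - s * t) / (1 - t) * (1 - x)
      + (ln (1 - s * t) / (1 - t)\<^sup>2 - s / ((1 - s * t) * (1 - t))) * ((1 - x) * (x - t))
      + ln (1 - s) / (1 - t)\<^sup>2 * (x - t)\<^sup>2 \<le> ln (1 - s * x)"
proof -
  define e where "e r = ln (1 - r * x) - (ln (1 - r * t) / (1 - t) * (1 - x)
      + (ln (1 - r * t) / (1 - t)\<^sup>2 - r / ((1 - r * t) * (1 - t))) * ((1 - x) * (x - t))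
      + ln (1 - r) / (1 - t)\<^sup>2 * (x - t)\<^sup>2)" for r
  have "e 0 \<le> e s"
  proof (rule DERIV_nonneg_imp_nondecreasing[OF s(1)])
    fix r assume r: "0 \<le> r" "r \<le> s"
    have "r * x \<le> r" "r * t \<le> r" using r x t by (simp_all add: mult_left_le)
    then have pos: "0 < 1 - r" "0 < 1 - r * x" "0 < 1 - r * t" "0 < 1 - t" using r s t by auto
    have l: "((\<lambda>r. ln (1 - r * x)) has_real_derivative - x / (1 - r * x)) (at r)"
      "((\<lambda>r. ln (1 - r * t)) has_real_derivative - t / (1 - r * t)) (at r)"
      "((\<lambda>r. ln (1 - r)) has_real_derivative - 1 / (1 - r)) (at r)"
      using pos by (auto intro!: derivative_eq_intros)
    have q: "((\<lambda>r. r / ((1 - r * t) * (1 - t))) has_real_derivative 1 / ((1 - r * t)\<^sup>2 * (1 - t))) (at r)"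
      using pos by (auto intro!: derivative_eq_intros simp: divide_simps power2_eq_square) algebra+
    have deriv: "(e has_real_derivative - x / (1 - r * x) - (- t / (1 - r * t) / (1 - t) * (1 - x)
      + (- t / (1 - r * t) / (1 - t)\<^sup>2 - 1 / ((1 - r * t)\<^sup>2 * (1 - t))) * ((1 - x) * (x - t))
      + - 1 / (1 - r) / (1 - t)\<^sup>2 * (x - t)\<^sup>2)) (at r)" (is "(_ has_real_derivative ?D) _")
      unfolding e_def by (rule l q DERIV_diff DERIV_add DERIV_cmult_right DERIV_cdivide)+
    have D_eq: "?D = r\<^sup>2 * (x - t)\<^sup>2 * (1 - x) / ((1 - r * x) * (1 - r * t)\<^sup>2 * (1 - r))"
      using pos by (simp add: divide_simps) algebra
    have D_nonneg: "0 \<le> r\<^sup>2 * (x - t)\<^sup>2 * (1 - x) / ((1 - r * x) * (1 - r * t)\<^sup>2 * (1 - r))"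
      using pos r x by simp
    show "\<exists>y. (e has_real_derivative y) (at r) \<and> 0 \<le> y"
      using deriv D_nonneg unfolding D_eq by blast
  qed
  then show ?thesis by (simp add: e_def)
qed

text \<open>The same with the extra node 0, where the logarithm is 0, so the cubic has a factor
  \<open>x\<close>. Strict positivity of \<open>t\<close> separates the double node from 0.\<close>

lemma ln_ge_interpolation_0_t_t_1:
  fixes x s t :: real
  assumes x: "0 \<le> x" "x \<le> 1" and s: "0 \<le> s" "s < 1" and t: "0 < t" "t < 1"
  shows "ln (1 - s * t) / (t * (1 - t)) * (x * (1 - x))
      + (- s / ((1 - s * t) * (t * (1 - t))) - ln (1 - s * t) * (1 - 2 * t) / (t * (1 - t))\<^sup>2)
          * (x * (1 - x) * (x - t))
      + ln (1 - s) / (1 - t)\<^sup>2 * (x * (x - t)\<^sup>2) \<le> ln (1 - s * x)"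
proof -
  define e where "e r = ln (1 - r * x) - (ln (1 - r * t) / (t * (1 - t)) * (x * (1 - x))
      + (- r / ((1 - r * t) * (t * (1 - t))) - ln (1 - r * t) * (1 - 2 * t) / (t * (1 - t))\<^sup>2)
          * (x * (1 - x) * (x - t))
      + ln (1 - r) / (1 - t)\<^sup>2 * (x * (x - t)\<^sup>2))" for r
  have "e 0 \<le> e s"
  proof (rule DERIV_nonneg_imp_nondecreasing[OF s(1)])
    fix r assume r: "0 \<le> r" "r \<le> s"
    have "r * x \<le> r" "r * t \<le> r" using r x t by (simp_all add: mult_left_le)
    then have pos: "0 < 1 - r" "0 < 1 - r * x" "0 < 1 - r * t" "0 < 1 - t" using r s t by auto
    have l: "((\<lambda>r. ln (1 - r * x)) has_real_derivative - x / (1 - r * x)) (at r)"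
      "((\<lambda>r. ln (1 - r * t)) has_real_derivative - t / (1 - r * t)) (at r)"
      "((\<lambda>r. ln (1 - r)) has_real_derivative - 1 / (1 - r)) (at r)"
      using pos by (auto intro!: derivative_eq_intros)
    have q: "((\<lambda>r. - r / ((1 - r * t) * (t * (1 - t)))) has_real_derivative
        - 1 / ((1 - r * t)\<^sup>2 * (t * (1 - t)))) (at r)"
      using pos t by (auto intro!: derivative_eq_intros simp: divide_simps power2_eq_square) algebra+
    have deriv: "(e has_real_derivative - x / (1 - r * x) - (- t / (1 - r * t) / (t * (1 - t)) * (x * (1 - x))
      + (- 1 / ((1 - r * t)\<^sup>2 * (t * (1 - t))) - - t / (1 - r * t) * (1 - 2 * t) / (t * (1 - t))\<^sup>2)
          * (x * (1 - x) * (x - t))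
      + - 1 / (1 - r) / (1 - t)\<^sup>2 * (x * (x - t)\<^sup>2))) (at r)" (is "(_ has_real_derivative ?D) _")
      unfolding e_def by (rule l q DERIV_diff DERIV_add DERIV_cmult_right DERIV_cdivide)+
    have D_eq: "?D = r ^ 3 * x * (x - t)\<^sup>2 * (1 - x) / ((1 - r * x) * (1 - r * t)\<^sup>2 * (1 - r))"
    proof -
      \<comment> \<open>After the factor \<open>x\<close> is taken out, what remains is the
        interpolant of \<open>1 / (1 - r * x)\<close> at the nodes \<open>t\<close>,
        \<open>t\<close>, 1 minus that function: \<open>U\<close> is the function, and
        \<open>L\<close>, \<open>K\<close>, \<open>W\<close> are the coefficients of the
        interpolant. All divisions by \<open>t\<close> have cancelled.\<close>
      define K L U W where "K = r / ((1 - r * t)\<^sup>2 * (1 - t)) + 1 / ((1 - r * t) * (1 - t)\<^sup>2)"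
        and "L = 1 / ((1 - r * t) * (1 - t))" and "U = 1 / (1 - r * x)" and "W = 1 / ((1 - r) * (1 - t)\<^sup>2)"
      note defs = K_def L_def U_def W_def
      have eqs: "- 1 / ((1 - r * t)\<^sup>2 * (t * (1 - t))) - - t / (1 - r * t) * (1 - 2 * t) / (t * (1 - t))\<^sup>2 = - K"
        "- t / (1 - r * t) / (t * (1 - t)) = - L" "- x / (1 - r * x) = - x * U" "- 1 / (1 - r) / (1 - t)\<^sup>2 = - W"
        unfolding defs using pos t by (simp_all add: divide_simps) algebra
      have "?D = x * (- U + L * (1 - x) + K * ((1 - x) * (x - t)) + W * (x - t)\<^sup>2)"
        unfolding eqs by algebra
      also have "- U + L * (1 - x) + K * ((1 - x) * (x - t)) + W * (x - t)\<^sup>2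
          = r ^ 3 * (x - t)\<^sup>2 * (1 - x) / ((1 - r * x) * (1 - r * t)\<^sup>2 * (1 - r))"
        unfolding defs using pos by (simp add: divide_simps) algebra
      finally show ?thesis by simp
    qed
    have D_nonneg: "0 \<le> r ^ 3 * x * (x - t)\<^sup>2 * (1 - x) / ((1 - r * x) * (1 - r * t)\<^sup>2 * (1 - r))"
      using pos r x by simp
    show "\<exists>y. (e has_real_derivative y) (at r) \<and> 0 \<le> y"
      using deriv D_nonneg unfolding D_eq by blast
  qed
  then show ?thesis by (simp add: e_def)
qed

subsection \<open>Moment bounds\<close>

lemma integral_cubic:
  fixes c0 c1 c2 c3 :: real
  assumes F: "F \<in> unit_distributions"
  shows "integrable F (\<lambda>y. c0 + c1 * y + c2 * y\<^sup>2 + c3 * y ^ 3)"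
    and "(\<integral>y. c0 + c1 * y + c2 * y\<^sup>2 + c3 * y ^ 3 \<partial>F) =
      c0 + c1 * (\<integral>y. y ^ 1 \<partial>F) + c2 * (\<integral>y. y ^ 2 \<partial>F) + c3 * (\<integral>y. y ^ 3 \<partial>F)"
proof -
  interpret prob_space F using unit_distributionsD(1)[OF F] .
  have i: "integrable F (\<lambda>y. y)" "integrable F (\<lambda>y. y\<^sup>2)" "integrable F (\<lambda>y. y ^ 3)"
    using integrable_power_unit_distribution[OF F, of 1] integrable_power_unit_distribution[OF F] by simp_all
  then show "integrable F (\<lambda>y. c0 + c1 * y + c2 * y\<^sup>2 + c3 * y ^ 3)" by simp
  show "(\<integral>y. c0 + c1 * y + c2 * y\<^sup>2 + c3 * y ^ 3 \<partial>F) =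
      c0 + c1 * (\<integral>y. y ^ 1 \<partial>F) + c2 * (\<integral>y. y ^ 2 \<partial>F) + c3 * (\<integral>y. y ^ 3 \<partial>F)"
    using i by (simp add: prob_space)
qed

text \<open>The integral of a polynomial minorant depends on \<open>F\<close> only through its
  moments, so the resulting bound is the same throughout a moment class. For fewer than three
  prescribed moments the higher coefficients are set to 0.\<close>

lemma cubic_le_integral:
  fixes c0 c1 c2 c3 :: real
  assumes F: "F \<in> unit_distributions" and \<phi>: "integrable F \<phi>"
    and le: "\<And>y. 0 \<le> y \<Longrightarrow> y \<le> 1 \<Longrightarrow> c0 + c1 * y + c2 * y\<^sup>2 + c3 * y ^ 3 \<le> \<phi> y"
  shows "c0 + c1 * (\<integral>y. y ^ 1 \<partial>F) + c2 * (\<integral>y. y ^ 2 \<partial>F) + c3 * (\<integral>y. y ^ 3 \<partial>F) \<le> (\<integral>y. \<phi> y \<partial>F)"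
  unfolding integral_cubic(2)[OF F, symmetric]
proof (rule integral_mono_AE[OF integral_cubic(1)[OF F] \<phi>])
  show "AE y in F. c0 + c1 * y + c2 * y\<^sup>2 + c3 * y ^ 3 \<le> \<phi> y"
    using unit_distributionsD(3)[OF F] by eventually_elim (use le in auto)
qed

text \<open>This is the source of all inequalities between moments below: they place the inner atom
  in the interval and make the weights of the extremal distribution nonnegative.\<close>

lemma cubic_moments_nonneg:
  fixes c0 c1 c2 c3 :: real
  assumes F: "F \<in> unit_distributions"
    and nn: "\<And>y. 0 \<le> y \<Longrightarrow> y \<le> 1 \<Longrightarrow> 0 \<le> c0 + c1 * y + c2 * y\<^sup>2 + c3 * y ^ 3"
  shows "0 \<le> c0 + c1 * (\<integral>y. y ^ 1 \<partial>F) + c2 * (\<integral>y. y ^ 2 \<partial>F) + c3 * (\<integral>y. y ^ 3 \<partial>F)"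
proof -
  have "- c0 + - c1 * (\<integral>y. y ^ 1 \<partial>F) + - c2 * (\<integral>y. y ^ 2 \<partial>F) + - c3 * (\<integral>y. y ^ 3 \<partial>F) \<le> (\<integral>y. 0 \<partial>F)"
  proof (rule cubic_le_integral[OF F])
    fix y :: real assume "0 \<le> y" "y \<le> 1"
    from nn[OF this] show "- c0 + - c1 * y + - c2 * y\<^sup>2 + - c3 * y ^ 3 \<le> 0" by simp
  qed simp
  then show ?thesis by simp
qed

lemma integrable_ln:
  assumes "F \<in> unit_distributions" "0 \<le> s" "s < 1"
  shows "integrable F (\<lambda>y. ln (1 - s * y))"
  using integrable_ln_tilt[of F s 0] assms by (simp add: mult.commute)

text \<open>Since \<open>1 - (y - \<mu>) * \<nu> = (1 + \<mu> * \<nu>) * (1 - s * y)\<close> with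
  \<open>s = \<nu> / (1 + \<mu> * \<nu>)\<close>, the two logarithms differ by a constant, which
  contributes equally to both sides because the weights sum to 1. The condition \<open>s < 1\<close>
  is the same as \<open>(1 - \<mu>) * \<nu> < 1\<close>.\<close>

lemma integral_ln_tilt:
  fixes \<mu> \<nu> :: real
  assumes F: "F \<in> unit_distributions" and I: "finite I"
    and x: "\<And>i. i \<in> I \<Longrightarrow> x i \<in> {0..1}" and f: "(\<Sum>i\<in>I. f i) = 1"
    and \<mu>: "0 \<le> \<mu>" and \<nu>: "0 \<le> \<nu>" "(1 - \<mu>) * \<nu> < 1"
    and ln_le: "\<And>s. 0 \<le> s \<Longrightarrow> s < 1 \<Longrightarrow> (\<Sum>i\<in>I. f i * ln (1 - s * x i)) \<le> (\<integral>y. ln (1 - s * y) \<partial>F)"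
  shows "(\<Sum>i\<in>I. f i * ln (1 - (x i - \<mu>) * \<nu>)) \<le> (\<integral>y. ln (1 - (y - \<mu>) * \<nu>) \<partial>F)"
proof -
  interpret prob_space F using unit_distributionsD(1)[OF F] .
  note [measurable_cong] = unit_distributionsD(2)[OF F]
  define s where "s = \<nu> / (1 + \<mu> * \<nu>)"
  have p: "0 < 1 + \<mu> * \<nu>" using \<mu> \<nu> by (simp add: add_pos_nonneg)
  have s: "0 \<le> s" "s < 1" using \<nu> p by (simp_all add: s_def field_simps)
  have split: "ln (1 - (y - \<mu>) * \<nu>) = ln (1 + \<mu> * \<nu>) + ln (1 - s * y)" if "y \<in> {0..1}" for y
  proof -
    have "s * y \<le> s" using that s by (simp add: mult_left_le)
    then have "0 < 1 - s * y" using s by linarith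
    moreover have "1 - (y - \<mu>) * \<nu> = (1 + \<mu> * \<nu>) * (1 - s * y)"
      using p by (simp add: s_def field_simps)
    ultimately show ?thesis using p by (simp add: ln_mult)
  qed
  note int = integrable_ln[OF F s]
  have "(\<Sum>i\<in>I. f i * ln (1 - (x i - \<mu>) * \<nu>)) = (\<Sum>i\<in>I. f i * ln (1 + \<mu> * \<nu>) + f i * ln (1 - s * x i))"
    by (intro sum.cong) (simp_all add: split[OF x] distrib_left)
  also have "\<dots> = ln (1 + \<mu> * \<nu>) + (\<Sum>i\<in>I. f i * ln (1 - s * x i))"
    using f by (simp add: sum.distrib flip: sum_distrib_right)
  also have "\<dots> \<le> (\<integral>y. ln (1 + \<mu> * \<nu>) + ln (1 - s * y) \<partial>F)"
    using ln_le[OF s] int by (simp add: prob_space)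
  also have "\<dots> = (\<integral>y. ln (1 - (y - \<mu>) * \<nu>) \<partial>F)"
  proof (rule integral_cong_AE)
    show "AE y in F. ln (1 + \<mu> * \<nu>) + ln (1 - s * y) = ln (1 - (y - \<mu>) * \<nu>)"
      using unit_distributionsD(3)[OF F] by eventually_elim (simp add: split)
  qed measurable
  finally show ?thesis .
qed

subsection \<open>The extremal distributions\<close>

lemma moment_classD:
  assumes "F \<in> moment_class d M"
  shows "F \<in> unit_distributions" "1 \<le> i \<Longrightarrow> i \<le> d \<Longrightarrow> (\<integral>y. y ^ i \<partial>F) = M i"
  using assms by (auto simp: moment_class_def)

lemma finite_distr_moment_class:
  assumes "finite I" "\<And>i. i \<in> I \<Longrightarrow> 0 \<le> w i" "(\<Sum>i\<in>I. w i) = 1" "\<And>i. i \<in> I \<Longrightarrow> x i \<in> {0..1}"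
    and "\<And>k. 1 \<le> k \<Longrightarrow> k \<le> d \<Longrightarrow> (\<Sum>i\<in>I. w i * x i ^ k) = M k"
  shows "finite_distr I x w \<in> moment_class d M"
  using assms finite_distr_unit[of I w x] integral_finite_distr[of I _ w x]
  by (auto simp: moment_class_def)

lemma mean_nonneg:
  assumes "F \<in> unit_distributions"
  shows "0 \<le> (\<integral>y. y ^ 1 \<partial>F)"
  using cubic_moments_nonneg[OF assms, of 0 1 0 0] by simp

section \<open>One prescribed moment, and the degenerate case of equal moments\<close>

lemma INF_D_min_Bernoulli:
  fixes m \<mu> :: real and C :: "real measure set"
  assumes m: "0 \<le> m" "m < \<mu>" and \<mu>: "\<mu> < 1"
    and C: "C \<subseteq> unit_distributions" "\<And>F. F \<in> C \<Longrightarrow> (\<integral>y. y ^ 1 \<partial>F) = m"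
    and mem: "finite_distr {0, 1 :: nat} real (\<lambda>i. if i = 0 then 1 - m else m) \<in> C"
  shows "(INF F\<in>C. D_min F \<mu>) = ereal (1 - m) * elog ((1 - m) / (1 - \<mu>)) + ereal m * elog (m / \<mu>)"
proof -
  \<comment> \<open>The affine tilt must equal the ratio of the Bernoulli weights with means
    \<open>m\<close> and \<open>\<mu>\<close> at both points 0 and 1; this determines
    \<open>\<nu>\<close>. For \<open>m = 0\<close> it is the boundary value
    \<open>1 / (1 - \<mu>)\<close>.\<close>
  define \<nu> where "\<nu> = (\<mu> - m) / (\<mu> * (1 - \<mu>))"
  define f g where "f i = (if i = 0 then 1 - m else m)" and "g i = (if i = 0 then 1 - \<mu> else \<mu>)" for i :: nat
  have pos: "0 < \<mu>" "0 < 1 - \<mu>" using m \<mu> by auto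
  have \<nu>: "0 < \<nu>" using m pos by (simp add: \<nu>_def)
  have h: "1 - (0 - \<mu>) * \<nu> = (1 - m) / (1 - \<mu>)" "1 - (1 - \<mu>) * \<nu> = m / \<mu>"
    using pos by (simp_all add: \<nu>_def field_simps)
  have "(INF F\<in>C. D_min F \<mu>) = (\<Sum>i\<in>{0, 1 :: nat}. ereal (f i) * elog (1 - (real i - \<mu>) * \<nu>))"
  proof (rule INF_D_min_eq[where g = g])
    show "(1 - \<mu>) * \<nu> \<le> 1" using h(2) m pos by (simp add: algebra_simps)
    show "f i = g i * (1 - (real i - \<mu>) * \<nu>)" if "i \<in> {0, 1}" for i
      using that h pos by (auto simp: f_def g_def)
    show "finite_distr {0, 1} real f \<in> C" using mem by (simp add: f_def[abs_def])
    fix F \<nu>' assume F: "F \<in> C" and \<nu>': "0 \<le> \<nu>'" "(1 - \<mu>) * \<nu>' < 1"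
    have Fu: "F \<in> unit_distributions" using F C by auto
    show "(\<Sum>i\<in>{0, 1}. f i * ln (1 - (real i - \<mu>) * \<nu>')) \<le> (\<integral>y. ln (1 - (y - \<mu>) * \<nu>') \<partial>F)"
    proof (rule integral_ln_tilt[OF Fu])
      fix s :: real assume s: "0 \<le> s" "s < 1"
      have "0 + ln (1 - s) * (\<integral>y. y ^ 1 \<partial>F) + 0 * (\<integral>y. y ^ 2 \<partial>F) + 0 * (\<integral>y. y ^ 3 \<partial>F)
          \<le> (\<integral>y. ln (1 - s * y) \<partial>F)"
        using ln_ge_interpolation_0_1 s by (intro cubic_le_integral[OF Fu integrable_ln[OF Fu s]]) simp
      then show "(\<Sum>i\<in>{0, 1}. f i * ln (1 - s * real i)) \<le> (\<integral>y. ln (1 - s * y) \<partial>F)"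
        using C(2)[OF F] by (simp add: f_def mult.commute)
    qed (use pos \<nu>' in \<open>auto simp: f_def\<close>)
  qed (use pos \<nu> \<mu> C in \<open>auto simp: g_def\<close>)
  also have "\<dots> = ereal (f 0) * elog (1 - (0 - \<mu>) * \<nu>) + ereal (f 1) * elog (1 - (1 - \<mu>) * \<nu>)"
    by simp
  finally show ?thesis unfolding h by (simp add: f_def)
qed

text \<open>All moments of a Bernoulli distribution equal its mean, so it belongs to the class as
  soon as the prescribed moments coincide, which for \<open>d = 1\<close> is no restriction.\<close>

lemma D_min_moments_Bernoulli:
  assumes ne: "moment_class d M \<noteq> {}" and d: "1 \<le> d" and \<mu>: "M 1 < \<mu>" "\<mu> < 1"
    and eq: "\<And>k. 1 \<le> k \<Longrightarrow> k \<le> d \<Longrightarrow> M k = M 1"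
  shows "D_min_moments d M \<mu> =
    ereal (1 - M 1) * elog ((1 - M 1) / (1 - \<mu>)) + ereal (M 1) * elog (M 1 / \<mu>)"
proof -
  obtain F where F: "F \<in> moment_class d M" using ne by auto
  have m: "0 \<le> M 1"
    using mean_nonneg[OF moment_classD(1)[OF F]] moment_classD(2)[OF F, of 1] d by simp
  show ?thesis
    unfolding D_min_moments_def
  proof (rule INF_D_min_Bernoulli[OF m \<mu>])
    show "finite_distr {0, 1 :: nat} real (\<lambda>i. if i = 0 then 1 - M 1 else M 1) \<in> moment_class d M"
    proof (rule finite_distr_moment_class)
      fix k :: nat assume "1 \<le> k" "k \<le> d"
      then show "(\<Sum>i\<in>{0, 1 :: nat}. (if i = 0 then 1 - M 1 else M 1) * real i ^ k) = M k"
        using eq[of k] by simp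
    qed (use m \<mu> in auto)
    show "(\<integral>y. y ^ 1 \<partial>G) = M 1" if "G \<in> moment_class d M" for G
      using that order_refl d by (rule moment_classD(2))
  qed (auto dest: moment_classD(1))
qed

section \<open>Two prescribed moments\<close>

lemma D_min_moments_2:
  assumes ne: "moment_class 2 M \<noteq> {}" and \<mu>: "M 1 < \<mu>" "\<mu> < 1"
    and \<nu>_def: "\<nu> = (1 - M 1) * (M 1 - \<mu>) / ((1 - M 1) * \<mu>\<^sup>2 - (1 - M 2) * \<mu> + M 1 - M 2)"
  shows "D_min_moments 2 M \<mu> =
    ereal ((1 - M 1)\<^sup>2 / (1 - 2 * M 1 + M 2)) * elog (1 - ((M 1 - M 2) / (1 - M 1) - \<mu>) * \<nu>) +
    ereal ((M 2 - (M 1)\<^sup>2) / (1 - 2 * M 1 + M 2)) * elog (1 - (1 - \<mu>) * \<nu>)"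
proof -
  obtain F where F: "F \<in> moment_class 2 M" using ne by auto
  have Fu: "F \<in> unit_distributions" and M: "(\<integral>y. y ^ 1 \<partial>F) = M 1" "(\<integral>y. y ^ 2 \<partial>F) = M 2"
    using moment_classD(1)[OF F] moment_classD(2)[OF F, of 1] moment_classD(2)[OF F, of 2] by simp_all
  \<comment> \<open>The atom \<open>t\<close> is determined by the condition that
    \<open>(1 - X) * (X - t)\<close>, which vanishes at both nodes, has mean 0. From here on
    everything is expressed through \<open>m\<close> and \<open>t\<close>.\<close>
  define m t where "m = M 1" and "t = (M 1 - M 2) / (1 - M 1)"
  have m: "0 \<le> m" "m < \<mu>" "m < 1" using mean_nonneg[OF Fu] M \<mu> by (auto simp: m_def)
  have pos: "0 < \<mu>" "0 < 1 - \<mu>" using m \<mu> by auto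
  have M1: "M 1 = m" and M2: "M 2 = m - t * (1 - m)"
    using m by (simp_all add: t_def m_def field_simps)
  have "0 \<le> M 1 - M 2"
    using cubic_moments_nonneg[OF Fu, of 0 1 "-1" 0] M by (auto simp: power2_eq_square mult_left_le)
  then have t0: "0 \<le> t" using m by (simp add: t_def m_def)
  \<comment> \<open>The variance is nonnegative and factors as \<open>(1 - m) * (m - t)\<close>,
    which gives \<open>t \<le> m\<close>.\<close>
  have "0 \<le> (M 1)\<^sup>2 + - 2 * M 1 * M 1 + 1 * M 2 + 0 * (\<integral>y. y ^ 3 \<partial>F)"
  proof -
    have "0 \<le> (M 1)\<^sup>2 + - 2 * M 1 * y + 1 * y\<^sup>2 + 0 * y ^ 3" for y
      using zero_le_power2[of "M 1 - y"] by (simp add: power2_eq_square algebra_simps)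
    then show ?thesis using cubic_moments_nonneg[OF Fu, of "(M 1)\<^sup>2" "- 2 * M 1" 1 0] M by simp
  qed
  then have "0 \<le> (1 - m) * (m - t)" unfolding M1 M2 by (simp add: power2_eq_square algebra_simps)
  then have tm: "t \<le> m" using m by (simp add: zero_le_mult_iff)
  have pt: "0 < 1 - t" "0 < \<mu> - t" using tm m by auto
  have \<nu>: "\<nu> = (\<mu> - m) / ((1 - \<mu>) * (\<mu> - t))"
  proof -
    have den: "(1 - M 1) * \<mu>\<^sup>2 - (1 - M 2) * \<mu> + M 1 - M 2 = - ((1 - m) * ((1 - \<mu>) * (\<mu> - t)))"
      and num: "(1 - M 1) * (M 1 - \<mu>) = - ((1 - m) * (\<mu> - m))"
      unfolding M1 M2 by algebra+
    show ?thesis unfolding \<nu>_def den num using m by simp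
  qed
  \<comment> \<open>On the points \<open>t\<close> and 1 a distribution is fixed by its mean:
    \<open>f\<close> is the one with mean \<open>m\<close>, \<open>g\<close> the one with mean
    \<open>\<mu>\<close>. For \<open>t = m\<close> the weight \<open>f 1\<close> is 0 and the tilt
    vanishes at 1.\<close>
  define f g x where "f i = (if i = 0 then (1 - m) / (1 - t) else (m - t) / (1 - t))"
    and "g i = (if i = 0 then (1 - \<mu>) / (1 - t) else (\<mu> - t) / (1 - t))"
    and "x i = (if i = 0 then t else 1)" for i :: nat
  have \<nu>_pos: "0 < \<nu>" using m pos pt by (simp add: \<nu>)
  have h: "1 - (t - \<mu>) * \<nu> = (1 - m) / (1 - \<mu>)" "1 - (1 - \<mu>) * \<nu> = (m - t) / (\<mu> - t)"
    unfolding \<nu> using pos pt by (simp_all add: divide_simps) algebra+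
  have f_sum: "(\<Sum>i\<in>{0, 1}. f i) = 1" and g_sum: "(\<Sum>i\<in>{0, 1}. g i) = 1"
    using pt by (simp_all add: f_def g_def flip: add_divide_distrib)
  have x: "x i \<in> {0..1}" for i using t0 pt by (auto simp: x_def)
  have den: "1 - 2 * M 1 + M 2 = (1 - m) * (1 - t)" and num: "M 2 - (M 1)\<^sup>2 = (1 - m) * (m - t)"
    unfolding M1 M2 by algebra+
  have "D_min_moments 2 M \<mu> = (\<Sum>i\<in>{0, 1 :: nat}. ereal (f i) * elog (1 - (x i - \<mu>) * \<nu>))"
    unfolding D_min_moments_def
  proof (rule INF_D_min_eq[where g = g])
    show "(\<Sum>i\<in>{0, 1}. g i * x i) = \<mu>"
      using pt by (simp add: g_def x_def divide_simps) algebra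
    show "(1 - \<mu>) * \<nu> \<le> 1"
    proof -
      have "0 \<le> (m - t) / (\<mu> - t)" using tm pt by simp
      then show ?thesis using h(2) by linarith
    qed
    show "f i = g i * (1 - (x i - \<mu>) * \<nu>)" if "i \<in> {0, 1}" for i
      using that h pos pt by (auto simp: f_def g_def x_def)
    show "finite_distr {0, 1} x f \<in> moment_class 2 M"
    proof (rule finite_distr_moment_class)
      fix k :: nat assume "1 \<le> k" "k \<le> 2"
      then have "k = 1 \<or> k = 2" by auto
      then show "(\<Sum>i\<in>{0, 1}. f i * x i ^ k) = M k"
      proof
        assume "k = 1"
        then show ?thesis unfolding \<open>k = 1\<close> M1 using pt by (simp add: f_def x_def divide_simps) algebra
      next
        assume "k = 2"
        then show ?thesis unfolding \<open>k = 2\<close> M2 using pt by (simp add: f_def x_def divide_simps) algebra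
      qed
    qed (use m tm pt x f_sum in \<open>auto simp: f_def\<close>)
    fix F \<nu>' assume F: "F \<in> moment_class 2 M" and \<nu>': "0 \<le> \<nu>'" "(1 - \<mu>) * \<nu>' < 1"
    have Fu: "F \<in> unit_distributions" and M: "(\<integral>y. y ^ 1 \<partial>F) = M 1" "(\<integral>y. y ^ 2 \<partial>F) = M 2"
      using moment_classD(1)[OF F] moment_classD(2)[OF F, of 1] moment_classD(2)[OF F, of 2] by simp_all
    show "(\<Sum>i\<in>{0, 1}. f i * ln (1 - (x i - \<mu>) * \<nu>')) \<le> (\<integral>y. ln (1 - (y - \<mu>) * \<nu>') \<partial>F)"
    proof (rule integral_ln_tilt[OF Fu])
      fix s :: real assume s: "0 \<le> s" "s < 1"
      define u v w where "u = ln (1 - s * t) / (1 - t)"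
        and "v = ln (1 - s * t) / (1 - t)\<^sup>2 - s / ((1 - s * t) * (1 - t))"
        and "w = ln (1 - s) / (1 - t)\<^sup>2"
      have "(u - t * v + t\<^sup>2 * w) + (- u + (1 + t) * v - 2 * t * w) * (\<integral>y. y ^ 1 \<partial>F)
          + (w - v) * (\<integral>y. y ^ 2 \<partial>F) + 0 * (\<integral>y. y ^ 3 \<partial>F) \<le> (\<integral>y. ln (1 - s * y) \<partial>F)"
      proof (rule cubic_le_integral[OF Fu integrable_ln[OF Fu s]])
        fix y :: real assume y: "0 \<le> y" "y \<le> 1"
        have "(u - t * v + t\<^sup>2 * w) + (- u + (1 + t) * v - 2 * t * w) * y + (w - v) * y\<^sup>2 + 0 * y ^ 3
            = u * (1 - y) + v * ((1 - y) * (y - t)) + w * (y - t)\<^sup>2"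
          by algebra
        also have "\<dots> \<le> ln (1 - s * y)"
          unfolding u_def v_def w_def using ln_ge_interpolation_t_t_1[OF y s t0] pt by simp
        finally show "(u - t * v + t\<^sup>2 * w) + (- u + (1 + t) * v - 2 * t * w) * y + (w - v) * y\<^sup>2 + 0 * y ^ 3
            \<le> ln (1 - s * y)" .
      qed
      \<comment> \<open>The coefficient \<open>v\<close> disappears because
        \<open>(1 - X) * (X - t)\<close> has mean 0, so the unknown slope at \<open>t\<close> does
        not enter.\<close>
      also have "(u - t * v + t\<^sup>2 * w) + (- u + (1 + t) * v - 2 * t * w) * (\<integral>y. y ^ 1 \<partial>F)
          + (w - v) * (\<integral>y. y ^ 2 \<partial>F) + 0 * (\<integral>y. y ^ 3 \<partial>F) = u * (1 - m) + w * ((m - t) * (1 - t))"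
        unfolding M M1 M2 by algebra
      also have "\<dots> = (\<Sum>i\<in>{0, 1}. f i * ln (1 - s * x i))"
        using pt by (simp add: f_def x_def u_def w_def power2_eq_square mult.commute)
      finally show "(\<Sum>i\<in>{0, 1}. f i * ln (1 - s * x i)) \<le> (\<integral>y. ln (1 - s * y) \<partial>F)" .
    qed (use pos \<nu>' x f_sum in auto)
  qed (use pos pt \<nu>_pos \<mu> x g_sum in \<open>auto simp: g_def dest: moment_classD\<close>)
  also have "\<dots> = ereal ((1 - m) / (1 - t)) * elog (1 - (t - \<mu>) * \<nu>)
      + ereal ((m - t) / (1 - t)) * elog (1 - (1 - \<mu>) * \<nu>)"
    by (simp add: f_def x_def)
  also have "(1 - m) / (1 - t) = (1 - M 1)\<^sup>2 / (1 - 2 * M 1 + M 2)"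
    unfolding den unfolding M1 using m by (simp add: power2_eq_square)
  also have "(m - t) / (1 - t) = (M 2 - (M 1)\<^sup>2) / (1 - 2 * M 1 + M 2)"
    unfolding den num using m by simp
  finally show ?thesis unfolding t_def .
qed

section \<open>Three prescribed moments\<close>

text \<open>The quadratic is negative at 0 and nonnegative at \<open>z\<close>, so it crosses zero
  upwards in between. For either sign of \<open>a\<close> the plus sign in the formula selects the
  root with nonnegative derivative, because \<open>2 * a * \<nu> + b\<close> is the square root of
  the discriminant.\<close>

lemma quadratic_root_properties:
  fixes a b c z \<nu> :: real
  assumes c: "0 < c" and z: "0 < z" "0 \<le> a * z\<^sup>2 + b * z - c"
    and \<nu>: "\<nu> = (if a \<noteq> 0 then (- b + sqrt (b\<^sup>2 + 4 * a * c)) / (2 * a) else c / b)"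
  shows "a * \<nu>\<^sup>2 + b * \<nu> - c = 0" "0 < \<nu>" "\<nu> \<le> z" "0 \<le> 2 * a * \<nu> + b"
proof -
  have "(a * \<nu>\<^sup>2 + b * \<nu> - c = 0) \<and> 0 < \<nu> \<and> \<nu> \<le> z \<and> 0 \<le> 2 * a * \<nu> + b"
  proof (cases "a = 0")
    case True
    have "0 < b * z" using True z c by simp
    then have "0 < b" using z by (simp add: zero_less_mult_iff)
    moreover have "\<nu> = c / b" using True \<nu> by simp
    ultimately show ?thesis using True z c by (simp add: divide_le_eq mult.commute)
  next
    case False
    define s where "s = sqrt (b\<^sup>2 + 4 * a * c)"
    have \<nu>': "\<nu> = (s - b) / (2 * a)" using False \<nu> by (simp add: s_def)
    have lin: "2 * a * \<nu> + b = s" using False by (simp add: \<nu>')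
    \<comment> \<open>Comparing \<open>\<nu>\<close> with \<open>z\<close> means comparing the
      square root with \<open>b + 2 * a * z\<close>. This identity reduces that to the sign of the
      quadratic at \<open>z\<close>; for \<open>a < 0\<close> it also shows that the discriminant is
      nonnegative.\<close>
    have sq: "(b + 2 * a * z)\<^sup>2 - (b\<^sup>2 + 4 * a * c) = 4 * a * (a * z\<^sup>2 + b * z - c)" by algebra
    consider "0 < a" | "a < 0" using False by linarith
    then show ?thesis
    proof cases
      case 1
      have D: "b\<^sup>2 < b\<^sup>2 + 4 * a * c" using 1 c by simp
      have "s\<^sup>2 = b\<^sup>2 + 4 * a * c" unfolding s_def using le_less_trans[OF zero_le_power2 D] by simp
      then have root: "a * \<nu>\<^sup>2 + b * \<nu> - c = 0"
        using lin False by algebra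
      have "\<bar>b\<bar> < s" using real_sqrt_less_mono[OF D] by (simp add: s_def)
      then have pos: "0 < \<nu>" using 1 by (simp add: \<nu>')
      have "0 < (a * z + b) * z" using z c by (simp add: power2_eq_square algebra_simps)
      then have "0 < a * z + b" using z by (simp add: zero_less_mult_iff)
      then have nn: "0 \<le> b + 2 * a * z" using mult_pos_pos[OF 1 z(1)] by linarith
      have "0 \<le> 4 * a * (a * z\<^sup>2 + b * z - c)" using 1 z by simp
      then have "b\<^sup>2 + 4 * a * c \<le> (b + 2 * a * z)\<^sup>2" using sq by linarith
      then have "s \<le> b + 2 * a * z" using nn unfolding s_def by (rule real_le_lsqrt[rotated])
      then have "\<nu> \<le> z" using 1 by (simp add: \<nu>' field_simps)
      then show ?thesis using root pos lin D by (simp add: s_def)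
    next
      case 2
      have "4 * a * (a * z\<^sup>2 + b * z - c) \<le> 0" using 2 z by (simp add: mult_nonpos_nonneg)
      then have ge: "(b + 2 * a * z)\<^sup>2 \<le> b\<^sup>2 + 4 * a * c" using sq by linarith
      then have D: "0 \<le> b\<^sup>2 + 4 * a * c" using order_trans[OF zero_le_power2] by blast
      then have "s\<^sup>2 = b\<^sup>2 + 4 * a * c" unfolding s_def by simp
      then have root: "a * \<nu>\<^sup>2 + b * \<nu> - c = 0"
        using lin False by algebra
      have "a * z\<^sup>2 < 0" using 2 z by (simp add: mult_neg_pos)
      then have "0 < b * z" using z c by linarith
      then have b: "0 < b" using z by (simp add: zero_less_mult_iff)
      have "s < b" using 2 c b unfolding s_def by (intro real_less_lsqrt) (auto simp: mult_neg_pos)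
      then have pos: "0 < \<nu>" using 2 by (simp add: \<nu>' zero_less_divide_iff)
      have "b + 2 * a * z \<le> s" using real_le_rsqrt[OF ge] by (simp add: s_def)
      then have "\<nu> \<le> z" using 2 by (simp add: \<nu>' field_simps)
      then show ?thesis using root pos lin D by (simp add: s_def)
    qed
  qed
  then show "a * \<nu>\<^sup>2 + b * \<nu> - c = 0" "0 < \<nu>" "\<nu> \<le> z" "0 \<le> 2 * a * \<nu> + b" by auto
qed

text \<open>The dual measure has weights \<open>f\<^sub>i / h\<^sub>i\<close>, except at the atom \<open>1\<close>, where \<open>h\<^sub>3\<close> may vanish; there
  the weight is read off from the mean. The sign of the derivative makes that weight nonnegative.\<close>

lemma three_point_dual:
  fixes \<mu> t f1 f2 f3 \<nu> :: real
  defines "h1 \<equiv> 1 - (0 - \<mu>) * \<nu>" and "h2 \<equiv> 1 - (t - \<mu>) * \<nu>" and "h3 \<equiv> 1 - (1 - \<mu>) * \<nu>"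
  assumes \<mu>: "0 < \<mu>" "\<mu> < 1" and t: "t < 1" and \<nu>: "0 < \<nu>" "0 \<le> h3"
    and f: "0 \<le> f1" "0 \<le> f2" "0 \<le> f3" "f1 + f2 + f3 = 1"
    and crit: "f1 * (0 - \<mu>) * h2 * h3 + f2 * (t - \<mu>) * h1 * h3 + f3 * (1 - \<mu>) * h1 * h2 = 0"
    and deriv: "f1 * (0 - \<mu>) * ((t - \<mu>) * h3 + (1 - \<mu>) * h2) +
      f2 * (t - \<mu>) * ((0 - \<mu>) * h3 + (1 - \<mu>) * h1) +
      f3 * (1 - \<mu>) * ((0 - \<mu>) * h2 + (t - \<mu>) * h1) \<le> 0"
  obtains g1 g2 g3 where "0 \<le> g1" "0 \<le> g2" "0 \<le> g3" "g1 + g2 + g3 = 1" "g2 * t + g3 = \<mu>"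
    "f1 = g1 * h1" "f2 = g2 * h2" "f3 = g3 * h3"
proof -
  have h1: "0 < h1" using \<mu> \<nu> by (simp add: h1_def add_pos_pos)
  have "h2 = h3 + (1 - t) * \<nu>" by (simp add: h2_def h3_def algebra_simps)
  then have h2: "0 < h2" using \<nu> t by (simp add: add_nonneg_pos)
  \<comment> \<open>\<open>Q\<close> is \<open>h1 * h2\<close> times the contribution of the atoms 0
    and \<open>t\<close> to the mean of \<open>X - \<mu>\<close> under the dual measure; the atom 1
    has to compensate it, so \<open>g3\<close> is nonnegative exactly when
    \<open>Q \<le> 0\<close>.\<close>
  define Q where "Q = f1 * (0 - \<mu>) * h2 + f2 * (t - \<mu>) * h1"
  have Qh3: "Q * h3 = - (f3 * (1 - \<mu>) * h1 * h2)" using crit unfolding Q_def by algebra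
  \<comment> \<open>For \<open>h3 > 0\<close> the sign follows from \<open>crit\<close>. For
    \<open>h3 = 0\<close>, \<open>crit\<close> forces \<open>f3 = 0\<close> and carries no further
    information, but \<open>deriv\<close> collapses to
    \<open>(1 - \<mu>) * Q \<le> 0\<close>.\<close>
  have Q: "Q \<le> 0"
  proof (cases "h3 = 0")
    case True
    then have "f3 = 0" using Qh3 \<mu> h1 h2 by simp
    then have "(1 - \<mu>) * Q \<le> 0" using deriv True by (simp add: Q_def algebra_simps)
    then show ?thesis using \<mu> by (simp add: mult_le_0_iff)
  next
    case False
    have "0 \<le> f3 * (1 - \<mu>) * h1 * h2" using f \<mu> h1 h2 by simp
    then have "Q * h3 \<le> 0" using Qh3 by simp
    then show ?thesis using False \<nu> by (simp add: mult_le_0_iff)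
  qed
  define g1 g2 g3 where "g1 = f1 / h1" and "g2 = f2 / h2" and "g3 = - Q / (h1 * h2 * (1 - \<mu>))"
  have fg: "f1 = g1 * h1" "f2 = g2 * h2" using h1 h2 by (auto simp: g1_def g2_def)
  have f3: "f3 = g3 * h3"
  proof -
    have "g3 * h3 = - (Q * h3) / (h1 * h2 * (1 - \<mu>))" by (simp add: g3_def)
    then show ?thesis using h1 h2 \<mu> by (simp add: Qh3)
  qed
  have "g3 * (1 - \<mu>) = - Q / (h1 * h2)" using \<mu> by (simp add: g3_def)
  also have "\<dots> = - (g1 * (0 - \<mu>) + g2 * (t - \<mu>))"
    using h1 h2 by (simp add: Q_def g1_def g2_def field_simps)
  finally have mean: "g1 * (0 - \<mu>) + g2 * (t - \<mu>) + g3 * (1 - \<mu>) = 0" by simp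
  have "g1 * h1 + g2 * h2 + g3 * h3 = 1" using f(4) fg f3 by simp
  \<comment> \<open>The tilt is 1 minus a multiple of \<open>X - \<mu>\<close>, whose mean under
    \<open>g\<close> is 0; hence the total mass of \<open>g\<close> equals that of
    \<open>f\<close>.\<close>
  then have sum: "g1 + g2 + g3 = 1" using mean unfolding h1_def h2_def h3_def by algebra
  show thesis
  proof (rule that[OF _ _ _ sum _ fg f3])
    show "g2 * t + g3 = \<mu>" using mean sum by algebra
    show "0 \<le> g3" using Q h1 h2 \<mu> by (simp add: g3_def divide_nonpos_pos)
  qed (use f h1 h2 in \<open>auto simp: g1_def g2_def\<close>)
qed

lemma D_min_moments_3:
  fixes M :: "nat \<Rightarrow> real" and \<mu> :: real
  assumes ne: "moment_class 3 M \<noteq> {}" and \<mu>: "M 1 < \<mu>" "\<mu> < 1"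
    and nd: "\<not> (M 1 = M 2 \<and> M 2 = M 3)"
    and x1: "x1 = - \<mu>" and x2: "x2 = (M 2 - M 3) / (M 1 - M 2) - \<mu>" and x3: "x3 = 1 - \<mu>"
    and f2: "f2 = (M 1 - M 2) ^ 3 / ((M 2 - M 3) * (M 1 - 2 * M 2 + M 3))"
    and f3: "f3 = (M 1 * M 3 - (M 2)\<^sup>2) / (M 1 - 2 * M 2 + M 3)"
    and f1: "f1 = 1 - f2 - f3"
    and a: "a = x1 * x2 * x3"
    and b: "b = (M 2 - 2 * \<mu> * M 1 + \<mu>\<^sup>2) + (x1 + x2 + x3) * (\<mu> - M 1)"
    and c: "c = \<mu> - M 1"
    and \<nu>: "\<nu> = (if a \<noteq> 0 then (- b + sqrt (b\<^sup>2 + 4 * a * c)) / (2 * a) else c / b)"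
  shows "D_min_moments 3 M \<mu> =
    ereal f1 * elog (1 - x1 * \<nu>) + ereal f2 * elog (1 - x2 * \<nu>) + ereal f3 * elog (1 - x3 * \<nu>)"
proof -
  have mom: "(\<integral>y. y ^ 1 \<partial>F) = M 1" "(\<integral>y. y ^ 2 \<partial>F) = M 2" "(\<integral>y. y ^ 3 \<partial>F) = M 3"
    if "F \<in> moment_class 3 M" for F
    using moment_classD(2)[OF that, of 1] moment_classD(2)[OF that, of 2]
      moment_classD(2)[OF that, of 3] by simp_all
  have nonneg: "0 \<le> c0 + c1 * M 1 + c2 * M 2 + c3 * M 3"
    if "\<And>y. 0 \<le> y \<Longrightarrow> y \<le> 1 \<Longrightarrow> 0 \<le> c0 + c1 * y + c2 * y\<^sup>2 + c3 * y ^ 3" for c0 c1 c2 c3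
  proof -
    obtain F where F: "F \<in> moment_class 3 M" using ne by auto
    show ?thesis using cubic_moments_nonneg[OF moment_classD(1)[OF F] that] unfolding mom[OF F] .
  qed
  have m: "0 \<le> M 1" using nonneg[of 0 1 0 0] by simp
  have pos: "0 < \<mu>" "0 < 1 - \<mu>" using m \<mu> by auto
  \<comment> \<open>\<open>p\<close> and \<open>q\<close> are the means of
    \<open>X * (1 - X)\<close> and \<open>X\<^sup>2 * (1 - X)\<close>. Their ratio \<open>t\<close>
    is the point for which \<open>X * (1 - X) * (X - t)\<close> has mean 0.\<close>
  define p q t where "p = M 1 - M 2" and "q = M 2 - M 3" and "t = q / p"
  have "0 \<le> p" unfolding p_def
    using nonneg[of 0 1 "-1" 0] by (auto simp: power2_eq_square mult_left_le)
  have q0: "0 \<le> q" unfolding q_def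
    using nonneg[of 0 0 1 "-1"] by (auto simp: power2_eq_square power3_eq_cube mult_left_le)
  have qp: "q \<le> p"
  proof -
    have "0 \<le> 0 + 1 * M 1 + - 2 * M 2 + 1 * M 3"
    proof (rule nonneg)
      fix y :: real assume "0 \<le> y" "y \<le> 1"
      have "0 + 1 * y + - 2 * y\<^sup>2 + 1 * y ^ 3 = y * (1 - y)\<^sup>2" by algebra
      then show "0 \<le> 0 + 1 * y + - 2 * y\<^sup>2 + 1 * y ^ 3" using \<open>0 \<le> y\<close> by simp
    qed
    then show ?thesis by (simp add: p_def q_def)
  qed
  have p: "0 < p"
  proof (rule ccontr)
    assume "\<not> 0 < p"
    then have "p = 0" "q = 0" using \<open>0 \<le> p\<close> q0 qp by auto
    then show False using nd by (simp add: p_def q_def)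
  qed
  \<comment> \<open>Cauchy-Schwarz with weight \<open>1 - X\<close>, proved through the optimal
    centre \<open>l\<close>. It will give \<open>0 \<le> f1\<close>.\<close>
  have q_ge: "p\<^sup>2 \<le> q * (1 - M 1)"
  proof -
    define l where "l = p / (1 - M 1)"
    have "0 \<le> l\<^sup>2 + (- 2 * l - l\<^sup>2) * M 1 + (1 + 2 * l) * M 2 + - 1 * M 3"
    proof (rule nonneg)
      fix y :: real assume "0 \<le> y" "y \<le> 1"
      have "l\<^sup>2 + (- 2 * l - l\<^sup>2) * y + (1 + 2 * l) * y\<^sup>2 + - 1 * y ^ 3 = (1 - y) * (y - l)\<^sup>2" by algebra
      then show "0 \<le> l\<^sup>2 + (- 2 * l - l\<^sup>2) * y + (1 + 2 * l) * y\<^sup>2 + - 1 * y ^ 3"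
        using \<open>y \<le> 1\<close> by simp
    qed
    also have "\<dots> = q - 2 * l * p + l * (l * (1 - M 1))" unfolding p_def q_def by algebra
    also have "\<dots> = q - p * l" using \<mu> by (simp add: l_def)
    finally show ?thesis using \<mu> by (simp add: l_def field_simps power2_eq_square)
  qed
  have "0 \<le> M 2" using nonneg[of 0 0 1 0] by simp
  then have m_pos: "0 < M 1" using p by (simp add: p_def)
  \<comment> \<open>Cauchy-Schwarz with weight \<open>X\<close>, applied to \<open>1 - X\<close>. It
    will give \<open>0 \<le> f3\<close>.\<close>
  have pq_ge: "p\<^sup>2 \<le> (p - q) * M 1"
  proof -
    define l where "l = p / M 1"
    have "0 \<le> 0 + (1 - l)\<^sup>2 * M 1 + - 2 * (1 - l) * M 2 + 1 * M 3"
    proof (rule nonneg)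
      fix y :: real assume "0 \<le> y" "y \<le> 1"
      have "0 + (1 - l)\<^sup>2 * y + - 2 * (1 - l) * y\<^sup>2 + 1 * y ^ 3 = y * (1 - y - l)\<^sup>2" by algebra
      then show "0 \<le> 0 + (1 - l)\<^sup>2 * y + - 2 * (1 - l) * y\<^sup>2 + 1 * y ^ 3"
        using \<open>0 \<le> y\<close> by simp
    qed
    also have "\<dots> = (p - q) - 2 * l * p + l * (l * M 1)" unfolding p_def q_def by algebra
    also have "\<dots> = (p - q) - p * l" using m_pos by (simp add: l_def)
    finally show ?thesis using m_pos by (simp add: l_def field_simps power2_eq_square)
  qed
  \<comment> \<open>Since \<open>p\<close> is nonzero, the two inequalities make \<open>q\<close>
    and \<open>p - q\<close> strictly positive, so \<open>t\<close> lies strictly between 0 and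
    1.\<close>
  have p2: "0 < p\<^sup>2" using p by simp
  have "0 < q * (1 - M 1)" "0 < (p - q) * M 1" using p2 q_ge pq_ge by linarith+
  then have q: "0 < q" "0 < p - q" using \<mu> m_pos by (auto simp: zero_less_mult_iff)
  have t: "0 < t" "0 < 1 - t" using p q by (auto simp: t_def)
  have qt: "q = t * p" using p by (simp add: t_def)
  have f2': "f2 = p / (t * (1 - t))"
  proof -
    have "f2 = p ^ 3 / (q * (p - q))" unfolding f2 p_def q_def by (simp add: algebra_simps)
    also have "\<dots> = (p * p\<^sup>2) / ((t * (1 - t)) * p\<^sup>2)" unfolding qt by (rule arg_cong2[where f = "(/)"]; algebra)
    finally show ?thesis using p by simp
  qed
  have f3': "f3 = M 1 - p / (1 - t)"
  proof -
    have "f3 = (p * (M 1 * (1 - t) - p)) / (p * (1 - t))"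
      unfolding f3
    proof (rule arg_cong2[where f = "(/)"])
      have M2: "M 2 = M 1 - p" and M3: "M 3 = M 1 - p - t * p" using qt by (auto simp: p_def q_def)
      show "M 1 * M 3 - (M 2)\<^sup>2 = p * (M 1 * (1 - t) - p)" "M 1 - 2 * M 2 + M 3 = p * (1 - t)"
        unfolding M2 M3 by algebra+
    qed
    then show ?thesis using p t by (simp add: diff_divide_distrib)
  qed
  have f1': "f1 = 1 - M 1 - p / t"
    unfolding f1 f2' f3' using t by (simp add: divide_simps) algebra
  have f_nn: "0 \<le> f1" "0 \<le> f2" "0 \<le> f3"
  proof -
    have e: "p / t = p\<^sup>2 / q" "p / (1 - t) = p\<^sup>2 / (p - q)"
      using p t by (simp_all add: qt power2_eq_square right_diff_distrib[symmetric] mult.commute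
          flip: mult.assoc) (simp_all add: field_simps)
    show "0 \<le> f1" unfolding f1' e using q_ge q by (simp add: divide_le_eq mult.commute)
    show "0 \<le> f3" unfolding f3' e using pq_ge q by (simp add: divide_le_eq mult.commute)
    show "0 \<le> f2" using p t by (simp add: f2')
  qed
  have f_sum: "f1 + f2 + f3 = 1" by (simp add: f1)
  have pf: "p = f2 * (t * (1 - t))" using t by (simp add: f2')
  have M1: "M 1 = f2 * t + f3" using t by (simp add: f2' f3')
  have M2: "M 2 = f2 * t\<^sup>2 + f3"
  proof -
    have "M 2 = M 1 - p" by (simp add: p_def)
    then show ?thesis unfolding M1 pf by algebra
  qed
  have M3: "M 3 = f2 * t ^ 3 + f3"
  proof -
    have "M 3 = M 2 - t * p" using qt by (simp add: q_def)
    then show ?thesis unfolding M2 pf by algebra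
  qed
  have x2': "x2 = t - \<mu>" by (simp add: x2 t_def p_def q_def)
  \<comment> \<open>The right side is the mean condition for the dual measure, the sum of
    \<open>f\<^sub>i * (x\<^sub>i - \<mu>) / h\<^sub>i\<close>, with denominators cleared. Its cubic
    part is absent, so \<open>\<nu>\<close> solves a quadratic.\<close>
  have crit: "a * r\<^sup>2 + b * r - c =
      f1 * (0 - \<mu>) * (1 - (t - \<mu>) * r) * (1 - (1 - \<mu>) * r)
      + f2 * (t - \<mu>) * (1 - (0 - \<mu>) * r) * (1 - (1 - \<mu>) * r)
      + f3 * (1 - \<mu>) * (1 - (0 - \<mu>) * r) * (1 - (t - \<mu>) * r)" for r
    unfolding a b c x1 x2' x3 f1 M1 M2 by algebra
  \<comment> \<open>This is the largest admissible parameter. There the tilt vanishes at 1 and only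
    the nonnegative term with \<open>f3\<close> survives in \<open>crit\<close>.\<close>
  define z where "z = 1 / (1 - \<mu>)"
  have z: "0 < z" "(1 - \<mu>) * z = 1" using pos by (auto simp: z_def)
  have "1 - (t - \<mu>) * z = (1 - t) * z" using z(2) by algebra
  then have z_nn: "0 \<le> a * z\<^sup>2 + b * z - c"
    unfolding crit using z pos t f_nn by simp
  have c_pos: "0 < c" using \<mu> by (simp add: c)
  note root = quadratic_root_properties[OF c_pos z(1) z_nn \<nu>]
  have h3: "0 \<le> 1 - (1 - \<mu>) * \<nu>"
    using mult_left_mono[OF root(3), of "1 - \<mu>"] z(2) pos by simp
  have deriv: "f1 * (0 - \<mu>) * ((t - \<mu>) * (1 - (1 - \<mu>) * \<nu>) + (1 - \<mu>) * (1 - (t - \<mu>) * \<nu>)) +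
      f2 * (t - \<mu>) * ((0 - \<mu>) * (1 - (1 - \<mu>) * \<nu>) + (1 - \<mu>) * (1 - (0 - \<mu>) * \<nu>)) +
      f3 * (1 - \<mu>) * ((0 - \<mu>) * (1 - (t - \<mu>) * \<nu>) + (t - \<mu>) * (1 - (0 - \<mu>) * \<nu>)) \<le> 0"
    (is "?L \<le> 0")
  proof -
    have "?L = - (2 * a * \<nu> + b)" unfolding a b x1 x2' x3 f1 M1 M2 by algebra
    then show ?thesis using root(4) by linarith
  qed
  obtain g1 g2 g3 where g: "0 \<le> g1" "0 \<le> g2" "0 \<le> g3" "g1 + g2 + g3 = 1" "g2 * t + g3 = \<mu>"
    and fg: "f1 = g1 * (1 - (0 - \<mu>) * \<nu>)" "f2 = g2 * (1 - (t - \<mu>) * \<nu>)" "f3 = g3 * (1 - (1 - \<mu>) * \<nu>)"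
    using three_point_dual[OF pos(1) \<mu>(2) _ root(2) h3 f_nn f_sum root(1)[unfolded crit] deriv] t by auto
  define f g x where "f i = (if i = 0 then f1 else if i = 1 then f2 else f3)"
    and "g i = (if i = 0 then g1 else if i = 1 then g2 else g3)"
    and "x i = (if i = 0 then 0 else if i = 1 then t else 1)" for i :: nat
  have x: "x i \<in> {0..1}" for i using t by (auto simp: x_def)
  have f_sum': "(\<Sum>i\<in>{0, 1, 2}. f i) = 1" using f_sum by (simp add: f_def)
  have "D_min_moments 3 M \<mu> = (\<Sum>i\<in>{0, 1, 2 :: nat}. ereal (f i) * elog (1 - (x i - \<mu>) * \<nu>))"
    unfolding D_min_moments_def
  proof (rule INF_D_min_eq[where g = g])
    show "(\<Sum>i\<in>{0, 1, 2}. g i) = 1" using g by (simp add: g_def)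
    show "(\<Sum>i\<in>{0, 1, 2}. g i * x i) = \<mu>" using g by (simp add: g_def x_def)
    show "(1 - \<mu>) * \<nu> \<le> 1" using h3 by simp
    show "f i = g i * (1 - (x i - \<mu>) * \<nu>)" if "i \<in> {0, 1, 2}" for i
      using fg by (simp add: f_def g_def x_def)
    show "finite_distr {0, 1, 2} x f \<in> moment_class 3 M"
    proof (rule finite_distr_moment_class)
      fix k :: nat assume "1 \<le> k" "k \<le> 3"
      then consider "k = 1" | "k = 2" | "k = 3" by linarith
      then show "(\<Sum>i\<in>{0, 1, 2}. f i * x i ^ k) = M k"
        by cases (simp_all add: f_def x_def M1[unfolded One_nat_def] M2 M3)
    qed (use f_nn x f_sum' in \<open>auto simp: f_def\<close>)
    fix F \<nu>' assume F: "F \<in> moment_class 3 M" and \<nu>': "0 \<le> \<nu>'" "(1 - \<mu>) * \<nu>' < 1"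
    note Fu = moment_classD(1)[OF F]
    show "(\<Sum>i\<in>{0, 1, 2}. f i * ln (1 - (x i - \<mu>) * \<nu>')) \<le> (\<integral>y. ln (1 - (y - \<mu>) * \<nu>') \<partial>F)"
    proof (rule integral_ln_tilt[OF Fu])
      fix s :: real assume s: "0 \<le> s" "s < 1"
      define u v w where "u = ln (1 - s * t) / (t * (1 - t))"
        and "v = - s / ((1 - s * t) * (t * (1 - t))) - ln (1 - s * t) * (1 - 2 * t) / (t * (1 - t))\<^sup>2"
        and "w = ln (1 - s) / (1 - t)\<^sup>2"
      have "0 + (u - t * v + t\<^sup>2 * w) * (\<integral>y. y ^ 1 \<partial>F) + (- u + (1 + t) * v - 2 * t * w) * (\<integral>y. y ^ 2 \<partial>F)
          + (w - v) * (\<integral>y. y ^ 3 \<partial>F) \<le> (\<integral>y. ln (1 - s * y) \<partial>F)"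
      proof (rule cubic_le_integral[OF Fu integrable_ln[OF Fu s]])
        fix y :: real assume y: "0 \<le> y" "y \<le> 1"
        have "0 + (u - t * v + t\<^sup>2 * w) * y + (- u + (1 + t) * v - 2 * t * w) * y\<^sup>2 + (w - v) * y ^ 3
            = u * (y * (1 - y)) + v * (y * (1 - y) * (y - t)) + w * (y * (y - t)\<^sup>2)"
          by algebra
        also have "\<dots> \<le> ln (1 - s * y)"
          unfolding u_def v_def w_def using ln_ge_interpolation_0_t_t_1[OF y s t(1)] t by simp
        finally show "0 + (u - t * v + t\<^sup>2 * w) * y + (- u + (1 + t) * v - 2 * t * w) * y\<^sup>2 + (w - v) * y ^ 3
            \<le> ln (1 - s * y)" .
      qed
      \<comment> \<open>Again \<open>v\<close> drops out, since \<open>X * (1 - X) * (X - t)\<close>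
        has mean 0. The atom 0 contributes nothing because the logarithm is 0 there.\<close>
      also have "0 + (u - t * v + t\<^sup>2 * w) * (\<integral>y. y ^ 1 \<partial>F) + (- u + (1 + t) * v - 2 * t * w) * (\<integral>y. y ^ 2 \<partial>F)
          + (w - v) * (\<integral>y. y ^ 3 \<partial>F) = f2 * (u * (t * (1 - t))) + f3 * (w * (1 - t)\<^sup>2)"
        unfolding mom[OF F] M1 M2 M3 by algebra
      also have "\<dots> = (\<Sum>i\<in>{0, 1, 2}. f i * ln (1 - s * x i))"
        using t by (simp add: f_def x_def u_def w_def)
      finally show "(\<Sum>i\<in>{0, 1, 2}. f i * ln (1 - s * x i)) \<le> (\<integral>y. ln (1 - s * y) \<partial>F)" .
    qed (use pos \<nu>' x f_sum' in auto)
  qed (use g root \<mu> x in \<open>auto simp: g_def dest: moment_classD(1)\<close>)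
  also have "\<dots> = ereal f1 * elog (1 - (0 - \<mu>) * \<nu>) + ereal f2 * elog (1 - (t - \<mu>) * \<nu>)
      + ereal f3 * elog (1 - (1 - \<mu>) * \<nu>)"
    by (simp add: f_def x_def add.assoc)
  finally show ?thesis unfolding x1 x2' x3 by simp
qed

subsection \<open>The closed forms\<close>

theorem theorem4:
  fixes d :: nat and M :: "nat \<Rightarrow> real" and \<mu> :: real
  assumes "d \<in> {1, 2, 3}"
    and "moment_class d M \<noteq> {}"
    and "M 1 < \<mu>" and "\<mu> < 1"
  shows
    "(d = 1 \<longrightarrow>
        D_min_moments d M \<mu> =
          ereal (1 - M 1) * elog ((1 - M 1) / (1 - \<mu>)) + ereal (M 1) * elog (M 1 / \<mu>)) \<and>
     (d = 2 \<longrightarrow>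
        (let \<nu> = (1 - M 1) * (M 1 - \<mu>) /
                 ((1 - M 1) * \<mu>\<^sup>2 - (1 - M 2) * \<mu> + M 1 - M 2)
         in D_min_moments d M \<mu> =
              ereal ((1 - M 1)\<^sup>2 / (1 - 2 * M 1 + M 2)) *
                elog (1 - ((M 1 - M 2) / (1 - M 1) - \<mu>) * \<nu>) +
              ereal ((M 2 - (M 1)\<^sup>2) / (1 - 2 * M 1 + M 2)) *
                elog (1 - (1 - \<mu>) * \<nu>))) \<and>
     (d = 3 \<longrightarrow>
        (if M 1 = M 2 \<and> M 2 = M 3
         then D_min_moments d M \<mu> = D_min_moments 1 M \<mu> \<and>
              D_min_moments d M \<mu> =
                ereal (1 - M 1) * elog ((1 - M 1) / (1 - \<mu>)) + ereal (M 1) * elog (M 1 / \<mu>)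
         else
          (let x1 = - \<mu>;
               x2 = (M 2 - M 3) / (M 1 - M 2) - \<mu>;
               x3 = 1 - \<mu>;
               f2 = (M 1 - M 2) ^ 3 / ((M 2 - M 3) * (M 1 - 2 * M 2 + M 3));
               f3 = (M 1 * M 3 - (M 2)\<^sup>2) / (M 1 - 2 * M 2 + M 3);
               f1 = 1 - f2 - f3;
               a = x1 * x2 * x3;
               b = (M 2 - 2 * \<mu> * M 1 + \<mu>\<^sup>2) + (x1 + x2 + x3) * (\<mu> - M 1);
               c = \<mu> - M 1;
               \<nu> = (if a \<noteq> 0 then (- b + sqrt (b\<^sup>2 + 4 * a * c)) / (2 * a) else c / b)
           in D_min_moments d M \<mu> =
                ereal f1 * elog (1 - x1 * \<nu>) +
                ereal f2 * elog (1 - x2 * \<nu>) +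
                ereal f3 * elog (1 - x3 * \<nu>))))"
proof -
  \<comment> \<open>Nonemptiness passes to the class with only the mean prescribed, so the
    one-moment formula is available for every \<open>d\<close>; the degenerate case of
    \<open>d = 3\<close> is compared with it.\<close>
  have "{1..1} \<subseteq> {1..d}" using assms(1) by auto
  then have "moment_class d M \<subseteq> moment_class 1 M" unfolding moment_class_def by blast
  then have D1: "D_min_moments 1 M \<mu> =
      ereal (1 - M 1) * elog ((1 - M 1) / (1 - \<mu>)) + ereal (M 1) * elog (M 1 / \<mu>)"
    using assms by (intro D_min_moments_Bernoulli) auto
  consider "d = 1" | "d = 2" | "d = 3" using assms(1) by auto
  then show ?thesis
  proof cases
    assume "d = 1"
    then show ?thesis using D1 by simp
  next
    assume d: "d = 2"
    show ?thesis
      unfolding d Let_def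
      by (intro conjI impI; (rule D_min_moments_2[OF assms(2)[unfolded d] assms(3,4) refl] | simp))
  next
    assume d: "d = 3"
    show ?thesis
    proof (cases "M 1 = M 2 \<and> M 2 = M 3")
      case True
      have "D_min_moments 3 M \<mu> =
          ereal (1 - M 1) * elog ((1 - M 1) / (1 - \<mu>)) + ereal (M 1) * elog (M 1 / \<mu>)"
      proof (rule D_min_moments_Bernoulli[OF assms(2)[unfolded d] _ assms(3,4)])
        fix k :: nat assume "1 \<le> k" "k \<le> 3"
        then consider "k = 1" | "k = 2" | "k = 3" by linarith
        then show "M k = M 1" using True by cases auto
      qed simp
      then show ?thesis using D1 True d by simp
    next
      case False
      show ?thesis
        unfolding d Let_def if_not_P[OF False]
        by (intro conjI impI; (rule D_min_moments_3[OF assms(2)[unfolded d] assms(3,4) False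
            refl refl refl refl refl refl refl refl refl refl] | simp))
    qed
  qed
qed

end
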